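(* In the setting described in the context, the condition number of the additive two-level Schwarz method with the R-GenEO coarse space $V_H$ satisfies $$\kappa(\mathbf{M}_{\mathrm{AS},2}^{-1}\mathbf{A}) \le (1+k_0)\Big(2 + k_0(2k_0+1)\max_{1\le j\le N}\Big(2 + \frac{3}{\lambda^j_{m_j+1}}\Big)\Big).$$
   Context: **Problem.** Let $\Omega\subset\mathbb{R}^d$, $d\in\{2,3\}$, be a domain with mesh $\mathcal{T}_h$, and let $V_h$ be a conforming (continuous, $H^1$) scalar finite element space on $\mathcal{T}_h$, with homogeneous Dirichlet conditions on the Dirichlet part of $\partial\Omega$ built in, and with finite element basis $\{\varphi_k\}_{k=1}^n$. Let $a(u,v)=\int_\Omega(\alpha(x)\nabla u)\cdot\nabla v\,dx$ be the bilinear form of a scalar second-order elliptic problem; $a$ is continuous, symmetric and coercive on $V_h$, and $a(u,v)=\sum_{\tau\in\mathcal{T}_h}a_\tau(u|_\tau,v|_\tau)$ with element contributions $a_\tau(u,v)=\int_\tau(\alpha\nabla u)\cdot\nabla v\,dx$, which are positive semidefinite. $\mathbf{A}$ is the matrix of $a$ in the basis $\{\varphi_k\}$. **Notation.** For a union $D$ of mesh elements (open/closed sets are identified up to element boundaries), $V_h(D)=\{v|_D: v\in V_h\}$, $V_{h,0}(D)=\{v|_D: v\in V_h,\ \mathrm{supp}(v)\subset D\}$ (support up to closure), $a_D(u,v)=\sum_{\tau\subset D}a_\tau(u|_\tau,v|_\tau)$, and $|\cdot|_{a,D}$ is the seminorm induced by $a_D$. **Decomposition.** $\{\Omega_j\}_{j=1}^N$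 is an overlapping decomposition of $\Omega$ into subdomains resolved by $\mathcal{T}_h$. $k_0=\max_{\tau\in\mathcal{T}_h}\#\{j:\tau\subset\Omega_j\}$. $R_j^\top:V_{h,0}(\Omega_j)\to V_h$ is extension by zero, with adjoint $R_j$. The overlap is $\Omega_j^\circ=\{x\in\Omega_j: x\in\Omega_{j'}\text{ for some }j'\ne j\}$. The partition of unity operators $\xi_j:V_h(\Omega_j)\to V_{h,0}(\Omega_j)$ are linear with $\sum_{j=1}^N R_j^\top\xi_j(v|_{\Omega_j})=v$ for all $v\in V_h$, and $\xi_j(v)=v$ on $\Omega_j\setminus\Omega_j^\circ$ for all $v\in V_h(\Omega_j)$ (by continuity also on $\Gamma_j^\circ$ below). They act locally: $\xi_j(v)|_{\overline{\Omega_j^\circ}}$ depends only on $v|_{\overline{\Omega_j^\circ}}$. **Strips.** $\Omega_j^\ast\subseteq\Omega_j$ is a union of mesh elements with $\Omega_j^\circ\subset\Omega_j^\ast$ (e.g. $\Omega_j^\circ$ extended by one layer of elements towards the interior of $\Omega_j$); it is a connected strip. Put $\omega_j^\circ=\overline{\Omega_j}\setminus\overline{\Omega_j^\circ}$, $\Gamma_j^\circ=\partial\Omega_j^\circ\cap\partial\omega_j^\circ$, $\omega_j^\ast=\overline{\Omega_j}\setminus\overline{\Omega_j^\ast}$, $\Gamma_j^\ast=\partial\Omega_j^\ast\cap\partial\omega_j^\ast$. The sets $\Gamma_j^\circ,\Gamma_j^\ast$ are non-empty and $\mathrm{dist}(\Gamma_j^\ast,\Gamma_j^\circ)\ge\delta$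 for some $\delta>0$. The maps $\eta_j:V_h(\Omega_j^\ast)\to V_{h,0}(\Omega_j^\ast)$ are linear with $(\eta_jv)(x)=(\xi_jv)(x)$ for $x\in\overline{\Omega_j^\circ}$; in particular $\eta_jv=0$ on $\Gamma_j^\ast$ and $\eta_jv=v$ on $\Gamma_j^\circ$. **Eigenproblems.** For each $j$ consider: find $(\lambda^j,t^j)$ with $t^j\in V_h(\Omega_j^\ast)$, $t^j\neq0$, and $a_{\Omega_j^\ast}(u,t^j)=\lambda^j\,a_{\Omega_j^\ast}(\eta_j(u),\eta_j(t^j))$ for all $u\in V_h(\Omega_j^\ast)$; elements of the kernel of $b_j(u,v)=a_{\Omega_j^\ast}(\eta_ju,\eta_jv)$ are assigned $\lambda^j=\infty$. Eigenvalues are ordered $0\le\lambda^j_1\le\lambda^j_2\le\dots\le\infty$ with multiplicity, with a corresponding basis of eigenvectors $t^j_k$, those with finite eigenvalue being $b_j$-orthonormal. The number $m_j\in\{1,\dots,\dim V_h(\Omega_j^\ast)\}$ is such that $0<\lambda^j_{m_j+1}<\infty$. **Harmonic extension.** $Q_j^\circ:V_h(\omega_j^\circ)\to V_{h,0}(\omega_j^\circ)$ is defined by $a_{\omega_j^\circ}(Q_j^\circ v,z)=a_{\omega_j^\circ}(v,z)$ for all $z\in V_{h,0}(\omega_j^\circ)$; $H_j^\circ=I-Q_j^\circ$; $\gamma_j^\circ v=v|_{\Gamma_j^\circ}$; $E_j^\circ:V_h(\Gamma_j^\circ)\to V_h(\omega_j^\circ)$ is any linear extension operator with $\gamma_j^\circ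 E_j^\circ=I$, where $V_h(\Gamma_j^\circ)$ is the space of traces. Define $y^j_k\in V_h(\Omega_j)$ by $y_k^j=t_k^j$ on $\overline{\Omega_j^\circ}$ and $y_k^j=H_j^\circ E_j^\circ\gamma_j^\circ t_k^j$ on $\omega_j^\circ$. **R-GenEO coarse space.** $V_H=\mathrm{span}\{R_j^\top\xi_j(y^j_k): k=1,\dots,m_j,\ j=1,\dots,N\}\subset V_h$. **Preconditioner.** $R_H^\top:V_H\to V_h$ is the natural embedding with adjoint $R_H$; $\mathbf{R}_j,\mathbf{R}_H$ are the matrix representations of $R_j,R_H$ (with respect to $\{\varphi_k\}$ and a basis of $V_H$). With $\mathbf{A}_j=\mathbf{R}_j\mathbf{A}\mathbf{R}_j^T$ and $\mathbf{A}_H=\mathbf{R}_H\mathbf{A}\mathbf{R}_H^T$, $$\mathbf{M}_{\mathrm{AS},2}^{-1}=\mathbf{R}_H^T\mathbf{A}_H^{-1}\mathbf{R}_H+\sum_{j=1}^N\mathbf{R}_j^T\mathbf{A}_j^{-1}\mathbf{R}_j.$$ $\kappa(\mathbf{M}_{\mathrm{AS},2}^{-1}\mathbf{A})$ denotes the ratio of the largest to the smallest eigenvalue of $\mathbf{M}_{\mathrm{AS},2}^{-1}\mathbf{A}$. *)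

theory Defs
  imports
    "HOL-Analysis.Analysis"
    "HOL-Library.Function_Algebras"
    "Jordan_Normal_Form.Gauss_Jordan_Elimination"
    "Jordan_Normal_Form.Char_Poly"
begin

instantiation "fun" :: (type, real_vector) real_vector
begin

definition scaleR_fun :: "real \<Rightarrow> ('a \<Rightarrow> 'b) \<Rightarrow> 'a \<Rightarrow> 'b"
  where "scaleR_fun c f = (\<lambda>x. c *\<^sub>R f x)"

instance
  by standard (auto simp: scaleR_fun_def plus_fun_def fun_eq_iff algebra_simps)

end

text \<open>
  A function on a closed set \<open>X\<close> is represented by its extension by zero to the whole space, so
  the restriction of a function to \<open>X\<close> is \<open>restr X\<close>, and extension by zero from a subset does not
  change the representing function: it does not appear as a separate operator below.
\<close>

definition restr :: "'a set \<Rightarrow> ('a \<Rightarrow> real) \<Rightarrow> 'a \<Rightarrow> real"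
  where "restr X v = (\<lambda>x. if x \<in> X then v x else 0)"

definition supp :: "('a::topological_space \<Rightarrow> real) \<Rightarrow> 'a set"
  where "supp v = closure {x. v x \<noteq> 0}"

definition lin_on :: "('a::real_vector) set \<Rightarrow> ('a \<Rightarrow> 'b::real_vector) \<Rightarrow> bool"
  where "lin_on V f \<longleftrightarrow> (\<forall>u\<in>V. \<forall>v\<in>V. f (u + v) = f u + f v) \<and> (\<forall>c. \<forall>v\<in>V. f (c *\<^sub>R v) = c *\<^sub>R f v)"

definition basis_on :: "'i set \<Rightarrow> ('i \<Rightarrow> 'a::real_vector) \<Rightarrow> 'a set \<Rightarrow> bool"
  where "basis_on I f V \<longleftrightarrow> inj_on f I \<and> independent (f ` I) \<and> span (f ` I) = V"

text \<open>The classical gradient; it is only meaningful where \<open>v\<close> is differentiable.\<close>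

definition grad :: "(real ^ 'd \<Rightarrow> real) \<Rightarrow> real ^ 'd \<Rightarrow> real ^ 'd"
  where "grad v x = (\<chi> i. frechet_derivative v (at x) (axis i 1))"

text \<open>Elements are closed.  They need not be polytopes, and hanging nodes are allowed.\<close>

definition is_mesh :: "(real ^ 'd) set \<Rightarrow> (real ^ 'd) set set \<Rightarrow> bool"
  where "is_mesh \<Omega> T \<longleftrightarrow> finite T \<and>
    (\<forall>\<tau>\<in>T. compact \<tau> \<and> interior \<tau> \<noteq> {} \<and> closure (interior \<tau>) = \<tau> \<and> negligible (frontier \<tau>)) \<and>
    (\<forall>\<tau>\<in>T. \<forall>\<sigma>\<in>T. \<tau> \<noteq> \<sigma> \<longrightarrow> interior \<tau> \<inter> interior \<sigma> = {}) \<and>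
    \<Union>T = closure \<Omega>"

definition shape_space :: "(real ^ 'd) set \<Rightarrow> (real ^ 'd \<Rightarrow> real) set \<Rightarrow> bool"
  where "shape_space \<tau> P \<longleftrightarrow> (\<exists>B. finite B \<and> P = span B) \<and>
    (\<forall>p\<in>P. continuous_on \<tau> p \<and> p differentiable_on interior \<tau>)"

definition fe_space :: "(real ^ 'd) set set \<Rightarrow> ((real ^ 'd) set \<Rightarrow> (real ^ 'd \<Rightarrow> real) set)
    \<Rightarrow> (real ^ 'd) set \<Rightarrow> (real ^ 'd \<Rightarrow> real) set"
  where "fe_space T P \<Gamma>D = {v. (\<forall>x. x \<notin> \<Union>T \<longrightarrow> v x = 0) \<and> continuous_on (\<Union>T) v \<and>
    (\<forall>\<tau>\<in>T. \<exists>p\<in>P \<tau>. \<forall>x\<in>\<tau>. v x = p x) \<and> (\<forall>x\<in>\<Gamma>D. v x = 0)}"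

text \<open>\<open>C\<^sup>1\<close> test functions; by density they define the same weak gradient as \<open>C\<^sup>\<infinity>\<close> ones.\<close>

definition test_function :: "(real ^ 'd) set \<Rightarrow> (real ^ 'd \<Rightarrow> real) \<Rightarrow> bool"
  where "test_function \<Omega> p \<longleftrightarrow> (\<forall>x. p differentiable (at x)) \<and> continuous_on UNIV (grad p) \<and>
    compact (supp p) \<and> supp p \<subseteq> \<Omega>"

text \<open>
  Membership in \<open>H\<^sup>1(\<Omega>)\<close> of a function that is differentiable in the interior of each mesh element:
  its elementwise gradient is square integrable and is the weak gradient.
\<close>

definition in_H1 :: "(real ^ 'd) set \<Rightarrow> (real ^ 'd \<Rightarrow> real) \<Rightarrow> bool"
  where "in_H1 \<Omega> v \<longleftrightarrow>
    set_integrable lebesgue \<Omega> (\<lambda>x. (v x)\<^sup>2) \<and>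
    set_integrable lebesgue \<Omega> (\<lambda>x. (norm (grad v x))\<^sup>2) \<and>
    (\<forall>p. test_function \<Omega> p \<longrightarrow>
      set_lebesgue_integral lebesgue \<Omega> (\<lambda>x. v x *\<^sub>R grad p x) =
      - set_lebesgue_integral lebesgue \<Omega> (\<lambda>x. p x *\<^sub>R grad v x))"

definition H1_norm :: "(real ^ 'd) set \<Rightarrow> (real ^ 'd \<Rightarrow> real) \<Rightarrow> real"
  where "H1_norm \<Omega> v = sqrt (set_lebesgue_integral lebesgue \<Omega> (\<lambda>x. (v x)\<^sup>2 + (norm (grad v x))\<^sup>2))"

text \<open>
  \<open>dform \<alpha> X u v\<close> is the integral of \<open>(\<alpha>\<nabla>u)\<cdot>\<nabla>v\<close> over \<open>X\<close>: the form \<open>a\<close> for \<open>X = \<Omega>\<close> and the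
  element contribution for \<open>X = \<tau>\<close>.  Since \<open>\<partial>\<tau>\<close> is a null set, the latter depends only on the
  restrictions of \<open>u\<close> and \<open>v\<close> to \<open>\<tau>\<close>.
\<close>

definition dform :: "(real ^ 'd \<Rightarrow> real ^ 'd ^ 'd) \<Rightarrow> (real ^ 'd) set
    \<Rightarrow> (real ^ 'd \<Rightarrow> real) \<Rightarrow> (real ^ 'd \<Rightarrow> real) \<Rightarrow> real"
  where "dform \<alpha> X u v = set_lebesgue_integral lebesgue X (\<lambda>x. inner (\<alpha> x *v grad u x) (grad v x))"

definition symmetric_on :: "'a set \<Rightarrow> ('a \<Rightarrow> 'a \<Rightarrow> real) \<Rightarrow> bool"
  where "symmetric_on V a \<longleftrightarrow> (\<forall>u\<in>V. \<forall>v\<in>V. a u v = a v u)"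

definition psd_on :: "'a set \<Rightarrow> ('a \<Rightarrow> 'a \<Rightarrow> real) \<Rightarrow> bool"
  where "psd_on V a \<longleftrightarrow> symmetric_on V a \<and> (\<forall>v\<in>V. 0 \<le> a v v)"

definition continuous_form_on :: "'a set \<Rightarrow> ('a \<Rightarrow> real) \<Rightarrow> ('a \<Rightarrow> 'a \<Rightarrow> real) \<Rightarrow> bool"
  where "continuous_form_on V nrm a \<longleftrightarrow> (\<exists>C. \<forall>u\<in>V. \<forall>v\<in>V. \<bar>a u v\<bar> \<le> C * nrm u * nrm v)"

definition coercive_on :: "'a set \<Rightarrow> ('a \<Rightarrow> real) \<Rightarrow> ('a \<Rightarrow> 'a \<Rightarrow> real) \<Rightarrow> bool"
  where "coercive_on V nrm a \<longleftrightarrow> (\<exists>c>0. \<forall>v\<in>V. c * (nrm v)\<^sup>2 \<le> a v v)"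

text \<open>
  A union of mesh elements is represented by the set \<open>D \<subseteq> T\<close> of its elements; the underlying
  closed set is \<open>\<Union>D\<close>.  This realises the identification of sets up to element boundaries.
\<close>

definition Vh_on :: "(real ^ 'd \<Rightarrow> real) set \<Rightarrow> (real ^ 'd) set set \<Rightarrow> (real ^ 'd \<Rightarrow> real) set"
  where "Vh_on V D = restr (\<Union>D) ` V"

definition Vh0_on :: "(real ^ 'd \<Rightarrow> real) set \<Rightarrow> (real ^ 'd) set set \<Rightarrow> (real ^ 'd \<Rightarrow> real) set"
  where "Vh0_on V D = restr (\<Union>D) ` {v \<in> V. supp v \<subseteq> \<Union>D}"

definition a_on :: "(real ^ 'd \<Rightarrow> real ^ 'd ^ 'd) \<Rightarrow> (real ^ 'd) set set
    \<Rightarrow> (real ^ 'd \<Rightarrow> real) \<Rightarrow> (real ^ 'd \<Rightarrow> real) \<Rightarrow> real"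
  where "a_on \<alpha> D u v = (\<Sum>\<tau>\<in>D. dform \<alpha> \<tau> u v)"

definition interface :: "(real ^ 'd) set set \<Rightarrow> (real ^ 'd) set set \<Rightarrow> (real ^ 'd) set"
  where "interface D D' = frontier (\<Union>D) \<inter> frontier (\<Union>D')"

text \<open>
  Below, \<open>S j\<close> represents \<open>\<Omega>\<^sub>j\<close>, \<open>overlap N S j\<close> represents \<open>\<Omega>\<^sub>j\<^sup>\<circ>\<close>, and \<open>inner_part N S j\<close>
  represents \<open>\<omega>\<^sub>j\<^sup>\<circ>\<close>.
\<close>

definition overlap :: "nat \<Rightarrow> (nat \<Rightarrow> 'e set) \<Rightarrow> nat \<Rightarrow> 'e set"
  where "overlap N S j = {\<tau> \<in> S j. \<exists>j'\<in>{1..N}. j' \<noteq> j \<and> \<tau> \<in> S j'}"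

definition inner_part :: "nat \<Rightarrow> (nat \<Rightarrow> 'e set) \<Rightarrow> nat \<Rightarrow> 'e set"
  where "inner_part N S j = S j - overlap N S j"

definition max_multiplicity :: "'e set \<Rightarrow> nat \<Rightarrow> (nat \<Rightarrow> 'e set) \<Rightarrow> nat"
  where "max_multiplicity T N S = Max ((\<lambda>\<tau>. card {j \<in> {1..N}. \<tau> \<in> S j}) ` T)"

definition partition_of_unity :: "(real ^ 'd \<Rightarrow> real) set \<Rightarrow> nat \<Rightarrow> (nat \<Rightarrow> (real ^ 'd) set set)
    \<Rightarrow> (nat \<Rightarrow> (real ^ 'd \<Rightarrow> real) \<Rightarrow> (real ^ 'd \<Rightarrow> real)) \<Rightarrow> bool"
  where "partition_of_unity V N S \<xi> \<longleftrightarrow>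
    (\<forall>j\<in>{1..N}.
      lin_on (Vh_on V (S j)) (\<xi> j) \<and>
      (\<forall>v\<in>Vh_on V (S j). \<xi> j v \<in> Vh0_on V (S j)) \<and>
      (\<forall>v\<in>Vh_on V (S j). \<forall>x\<in>\<Union>(S j) - \<Union>(overlap N S j). \<xi> j v x = v x) \<and>
      (\<forall>u\<in>Vh_on V (S j). \<forall>v\<in>Vh_on V (S j).
        restr (\<Union>(overlap N S j)) u = restr (\<Union>(overlap N S j)) v \<longrightarrow>
        restr (\<Union>(overlap N S j)) (\<xi> j u) = restr (\<Union>(overlap N S j)) (\<xi> j v))) \<and>
    (\<forall>v\<in>V. (\<Sum>j\<in>{1..N}. \<xi> j (restr (\<Union>(S j)) v)) = v)"

text \<open>
  A basis of \<open>V\<close> of eigenvectors \<open>t k\<close> (\<open>1 \<le> k \<le> dim V\<close>) of the pencil of \<open>a\<close> and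
  \<open>b u v = a (\<eta> u) (\<eta> v)\<close>, ordered by eigenvalue.  An eigenvector with finite eigenvalue has
  \<open>b\<close>-norm one, so it is not in the kernel of \<open>b\<close>.
\<close>

definition eigensystem :: "('a \<Rightarrow> 'a \<Rightarrow> real) \<Rightarrow> ('a \<Rightarrow> 'a) \<Rightarrow> ('a::real_vector) set
    \<Rightarrow> (nat \<Rightarrow> ereal) \<Rightarrow> (nat \<Rightarrow> 'a) \<Rightarrow> bool"
  where "eigensystem a \<eta> V lam t \<longleftrightarrow>
    basis_on {1..dim V} t V \<and>
    (\<forall>k\<in>{1..dim V}. 0 \<le> lam k \<and>
      (if lam k = \<infinity> then \<forall>u\<in>V. a (\<eta> u) (\<eta> (t k)) = 0
       else \<forall>u\<in>V. a u (t k) = real_of_ereal (lam k) * a (\<eta> u) (\<eta> (t k)))) \<and>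
    (\<forall>k\<in>{1..dim V}. \<forall>l\<in>{1..dim V}. k \<le> l \<longrightarrow> lam k \<le> lam l) \<and>
    (\<forall>k\<in>{1..dim V}. \<forall>l\<in>{1..dim V}. lam k \<noteq> \<infinity> \<longrightarrow> lam l \<noteq> \<infinity> \<longrightarrow>
      a (\<eta> (t k)) (\<eta> (t l)) = (if k = l then 1 else 0))"

text \<open>Unique if \<open>a\<close> is positive definite on the subspace \<open>W\<close>.\<close>

definition form_proj :: "('a \<Rightarrow> 'a \<Rightarrow> real) \<Rightarrow> 'a set \<Rightarrow> 'a \<Rightarrow> 'a"
  where "form_proj a W v = (THE q. q \<in> W \<and> (\<forall>z\<in>W. a q z = a v z))"

definition harmonic_part :: "('a \<Rightarrow> 'a \<Rightarrow> real) \<Rightarrow> 'a set \<Rightarrow> 'a \<Rightarrow> 'a::real_vector"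
  where "harmonic_part a W v = v - form_proj a W v"

text \<open>\<open>restr \<Gamma> ` V\<close> is the space of traces on \<open>\<Gamma>\<close>.\<close>

definition trace_extension :: "(real ^ 'd \<Rightarrow> real) set \<Rightarrow> (real ^ 'd) set \<Rightarrow> (real ^ 'd) set set
    \<Rightarrow> ((real ^ 'd \<Rightarrow> real) \<Rightarrow> (real ^ 'd \<Rightarrow> real)) \<Rightarrow> bool"
  where "trace_extension V \<Gamma> D E \<longleftrightarrow> lin_on (restr \<Gamma> ` V) E \<and>
    (\<forall>g\<in>restr \<Gamma> ` V. E g \<in> Vh_on V D \<and> restr \<Gamma> (E g) = g)"

definition glued_harmonic :: "(real ^ 'd \<Rightarrow> real ^ 'd ^ 'd) \<Rightarrow> (real ^ 'd \<Rightarrow> real) set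
    \<Rightarrow> (real ^ 'd) set set \<Rightarrow> (real ^ 'd) set set
    \<Rightarrow> ((real ^ 'd \<Rightarrow> real) \<Rightarrow> (real ^ 'd \<Rightarrow> real)) \<Rightarrow> (real ^ 'd \<Rightarrow> real) \<Rightarrow> real ^ 'd \<Rightarrow> real"
  where "glued_harmonic \<alpha> V D D' E t = (\<lambda>x.
    if x \<in> \<Union>D then t x
    else if x \<in> \<Union>D' then
      harmonic_part (a_on \<alpha> D') (Vh0_on V D') (E (restr (interface D D') t)) x
    else 0)"

definition coarse_space :: "(real ^ 'd \<Rightarrow> real ^ 'd ^ 'd) \<Rightarrow> (real ^ 'd \<Rightarrow> real) set \<Rightarrow> nat
    \<Rightarrow> (nat \<Rightarrow> (real ^ 'd) set set)
    \<Rightarrow> (nat \<Rightarrow> (real ^ 'd \<Rightarrow> real) \<Rightarrow> (real ^ 'd \<Rightarrow> real))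
    \<Rightarrow> (nat \<Rightarrow> (real ^ 'd \<Rightarrow> real) \<Rightarrow> (real ^ 'd \<Rightarrow> real))
    \<Rightarrow> (nat \<Rightarrow> nat \<Rightarrow> real ^ 'd \<Rightarrow> real) \<Rightarrow> (nat \<Rightarrow> nat) \<Rightarrow> (real ^ 'd \<Rightarrow> real) set"
  where "coarse_space \<alpha> V N S \<xi> E t m = span {\<xi> j
    (glued_harmonic \<alpha> V (overlap N S j) (inner_part N S j) (E j) (t j k)) |
      j k. j \<in> {1..N} \<and> k \<in> {1..m j}}"

definition stiffness_mat :: "('a \<Rightarrow> 'a \<Rightarrow> real) \<Rightarrow> nat \<Rightarrow> (nat \<Rightarrow> 'a) \<Rightarrow> real mat"
  where "stiffness_mat a n \<phi> = Matrix.mat n n (\<lambda>(i, k). a (\<phi> k) (\<phi> i))"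

text \<open>
  The matrix, with respect to the bases \<open>\<psi>\<^sub>0, \<dots>, \<psi>\<^bsub>p-1\<^esub>\<close> of a subspace and \<open>\<phi>\<^sub>0, \<dots>, \<phi>\<^bsub>n-1\<^esub>\<close> of the
  full space, of the embedding of the former into the latter.
\<close>

definition embedding_mat :: "nat \<Rightarrow> (nat \<Rightarrow> 'a::real_vector) \<Rightarrow> nat \<Rightarrow> (nat \<Rightarrow> 'a) \<Rightarrow> real mat"
  where "embedding_mat n \<phi> p \<psi> =
    Matrix.mat n p (\<lambda>(i, l). representation (\<phi> ` {..<n}) (\<psi> l) (\<phi> i))"

text \<open>With \<open>R = RT\<^sup>T\<close>, this is \<open>R\<^sup>T (R A R\<^sup>T)\<^sup>-\<^sup>1 R\<close>.\<close>

definition subspace_correction :: "real mat \<Rightarrow> real mat \<Rightarrow> real mat"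
  where "subspace_correction A RT =
    RT * the (mat_inverse (transpose_mat RT * A * RT)) * transpose_mat RT"

definition two_level_AS :: "nat \<Rightarrow> real mat \<Rightarrow> real mat \<Rightarrow> nat \<Rightarrow> (nat \<Rightarrow> real mat) \<Rightarrow> real mat"
  where "two_level_AS n A RHT N RT = subspace_correction A RHT +
    Matrix.mat n n (\<lambda>(i, k). \<Sum>j\<in>{1..N}. subspace_correction A (RT j) $$ (i, k))"

text \<open>
  Only real eigenvalues are considered; for symmetric positive definite \<open>M\<close> and \<open>A\<close> all eigenvalues
  of \<open>M * A\<close> are real.
\<close>

definition cond_number :: "real mat \<Rightarrow> real"
  where "cond_number B = Max {k. eigenvalue B k} / Min {k. eigenvalue B k}"

end

theory Submission
  imports Defs
begin

text \<open>
  The eigenvalues of the preconditioned matrix are those of the sum of the energy projections onto the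
  coarse space and the local spaces.  By the abstract theory of additive Schwarz methods
  (\<open>cond_number_two_level_AS_le\<close>), the largest is at most \<open>1 + k\<^sub>0\<close>, as on each element at most
  \<open>k\<^sub>0\<close> local functions are nonzero, and the smallest is at least \<open>1 / C\<close> if every \<open>v\<close> is the sum of a
  coarse component and local components whose energies add up to at most \<open>C\<close> times that of \<open>v\<close>.

  Such a decomposition comes from the eigenproblems.  On the strip, \<open>v\<close> is expanded in eigenvectors
  and the first \<open>m\<^sub>j\<close> terms are kept.  The same combination \<open>Y\<close> of the glued harmonic functions gives
  the coarse contribution \<open>\<xi>\<^sub>j Y\<close> and leaves the local component \<open>w = \<xi>\<^sub>j (v - Y)\<close>.  If \<open>r\<close> is the
  remainder of the expansion and \<open>e = \<eta>\<^sub>j r\<close>, then the energy of \<open>e\<close> is at most \<open>1 / \<lambda>\<close> times that of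
  \<open>v\<close> on the strip, where \<open>\<lambda>\<close> is the first discarded eigenvalue (\<open>eigensystem_truncation\<close>).  On the
  overlap \<open>w = e\<close>.  On the rest of the subdomain \<open>w = v - Y\<close> has the trace of \<open>e\<close>, and \<open>Y\<close> is
  orthogonal to all functions of trace zero, so that the energy of \<open>w\<close> is at most the sum of those of
  \<open>v\<close> and \<open>e\<close> there (\<open>energy_off_orthogonal_part\<close>).  Altogether the energy of \<open>w\<close> is at most
  \<open>1 + 1 / \<lambda> \<le> 2 + 3 / \<lambda>\<close> times that of \<open>v\<close> on the subdomain (\<open>stable_local_component\<close>).  Summation
  over the subdomains counts each element at most \<open>k\<^sub>0\<close> times; the coarse component is \<open>v\<close> minus the
  local ones, which gives \<open>C\<close> its factor \<open>2 k\<^sub>0 + 1\<close> and its summand \<open>2\<close> (\<open>stable_decomposition\<close>).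

  Two points of the discretisation carry this argument.  A function of trace zero on the interface
  extends by zero to a global finite element function because all finite element functions vanish
  where the part outside the overlap touches the complement of the subdomain
  (\<open>vanishes_at_outer_boundary\<close>).  Therefore the glued harmonic functions are restrictions of global
  ones (\<open>glued_harmonic_extension\<close>).
\<close>

section \<open>Semidefinite forms on a subspace\<close>

locale semi_inner =
  fixes V :: "'a::real_vector set" and a :: "'a \<Rightarrow> 'a \<Rightarrow> real"
  assumes subspace: "subspace V"
    and add_left: "\<lbrakk>u \<in> V; v \<in> V; w \<in> V\<rbrakk> \<Longrightarrow> a (u + v) w = a u w + a v w"
    and scale_left: "\<lbrakk>u \<in> V; w \<in> V\<rbrakk> \<Longrightarrow> a (c *\<^sub>R u) w = c * a u w"
    and psd: "psd_on V a"
begin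

lemma commute: "\<lbrakk>u \<in> V; v \<in> V\<rbrakk> \<Longrightarrow> a u v = a v u"
  using psd by (simp add: psd_on_def symmetric_on_def)

lemma nonneg: "v \<in> V \<Longrightarrow> 0 \<le> a v v"
  using psd by (simp add: psd_on_def)

lemmas mem = subspace_add[OF subspace] subspace_scale[OF subspace] subspace_diff[OF subspace]
  subspace_0[OF subspace] subspace_sum[OF subspace]

lemma add_right: "\<lbrakk>u \<in> V; v \<in> V; w \<in> V\<rbrakk> \<Longrightarrow> a w (u + v) = a w u + a w v"
  by (metis add_left commute mem(1))

lemma scale_right: "\<lbrakk>u \<in> V; w \<in> V\<rbrakk> \<Longrightarrow> a w (c *\<^sub>R u) = c * a w u"
  by (metis scale_left commute mem(2))

lemma zero_left: "w \<in> V \<Longrightarrow> a 0 w = 0"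
  using scale_left[of 0 w 0] mem(4) by simp

lemma zero_right: "w \<in> V \<Longrightarrow> a w 0 = 0"
  using scale_right[of 0 w 0] mem(4) by simp

lemma diff_left: "\<lbrakk>u \<in> V; v \<in> V; w \<in> V\<rbrakk> \<Longrightarrow> a (u - v) w = a u w - a v w"
  using add_left[of "u - v" v w] mem(3)[of u v] by simp

lemma diff_right: "\<lbrakk>u \<in> V; v \<in> V; w \<in> V\<rbrakk> \<Longrightarrow> a w (u - v) = a w u - a w v"
  using add_right[of "u - v" v w] mem(3)[of u v] by simp

lemma sum_left: "\<lbrakk>\<And>i. i \<in> I \<Longrightarrow> f i \<in> V; w \<in> V\<rbrakk> \<Longrightarrow> a (\<Sum>i\<in>I. f i) w = (\<Sum>i\<in>I. a (f i) w)"
proof (induction I rule: infinite_finite_induct)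
  case (insert i I)
  then show ?case using add_left[of "f i" "\<Sum>i\<in>I. f i" w] mem(5)[of I f] by simp
qed (auto simp: zero_left)

lemma sum_right: "\<lbrakk>\<And>i. i \<in> I \<Longrightarrow> f i \<in> V; w \<in> V\<rbrakk> \<Longrightarrow> a w (\<Sum>i\<in>I. f i) = (\<Sum>i\<in>I. a w (f i))"
proof (induction I rule: infinite_finite_induct)
  case (insert i I)
  then show ?case using add_right[of "f i" "\<Sum>i\<in>I. f i" w] mem(5)[of I f] by simp
qed (auto simp: zero_right)

lemma sum_sum:
  assumes "\<And>k. k \<in> K \<Longrightarrow> t k \<in> V" "\<And>l. l \<in> L \<Longrightarrow> s l \<in> V"
  shows "a (\<Sum>k\<in>K. c k *\<^sub>R t k) (\<Sum>l\<in>L. d l *\<^sub>R s l) = (\<Sum>k\<in>K. \<Sum>l\<in>L. c k * d l * a (t k) (s l))"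
proof -
  have sV: "(\<Sum>l\<in>L. d l *\<^sub>R s l) \<in> V" using assms by (intro mem(5) mem(2))
  have "a (\<Sum>k\<in>K. c k *\<^sub>R t k) (\<Sum>l\<in>L. d l *\<^sub>R s l) = (\<Sum>k\<in>K. a (c k *\<^sub>R t k) (\<Sum>l\<in>L. d l *\<^sub>R s l))"
    using assms sV by (intro sum_left mem(2))
  also have "\<dots> = (\<Sum>k\<in>K. \<Sum>l\<in>L. a (c k *\<^sub>R t k) (d l *\<^sub>R s l))"
    using assms by (intro sum.cong refl sum_right mem(2))
  also have "\<dots> = (\<Sum>k\<in>K. \<Sum>l\<in>L. c k * d l * a (t k) (s l))"
    using assms by (intro sum.cong refl) (simp add: scale_left scale_right mem)
  finally show ?thesis .
qed

lemmas bilinear = add_left add_right scale_left scale_right diff_left diff_right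

lemma Cauchy_Schwarz:
  assumes "u \<in> V" "v \<in> V"
  shows "(a u v)\<^sup>2 \<le> a u u * a v v"
proof -
  have q: "0 \<le> a u u + 2 * s * a u v + s\<^sup>2 * a v v" for s
    using nonneg[of "u + s *\<^sub>R v"] assms commute[of u v]
    by (simp add: bilinear mem algebra_simps power2_eq_square)
  show ?thesis
  proof (cases "a v v = 0")
    case True
    have "a u v = 0"
    proof (rule ccontr)
      assume "a u v \<noteq> 0"
      then show False
        \<comment> \<open>If \<open>a v v = 0\<close>, then the quadratic is affine in \<open>s\<close>; this \<open>s\<close> gives it the value \<open>- 1\<close>.\<close>
        using q[of "- (a u u + 1) / (2 * a u v)"] True by (simp add: field_simps)
    qed
    then show ?thesis using True by simp
  next
    case False
    then have "0 < a v v" using nonneg[of v] assms by simp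
    then show ?thesis
      using q[of "- a u v / a v v"] by (simp add: field_simps power2_eq_square)
  qed
qed

lemma orthogonal_null:
  assumes "u \<in> V" "v \<in> V" "a v v = 0"
  shows "a u v = 0"
  using Cauchy_Schwarz[of u v] assms by simp

lemma norm_diff_le:
  assumes "u \<in> V" "v \<in> V"
  shows "a (u - v) (u - v) \<le> 2 * a u u + 2 * a v v"
  using nonneg[of "u + v"] assms by (simp add: bilinear mem commute)

lemma norm_sum_le:
  assumes "finite I" "\<And>i. i \<in> I \<Longrightarrow> f i \<in> V"
  shows "a (\<Sum>i\<in>I. f i) (\<Sum>i\<in>I. f i) \<le> real (card I) * (\<Sum>i\<in>I. a (f i) (f i))"
proof -
  have "a (f k) (f i) \<le> (a (f i) (f i) + a (f k) (f k)) / 2" if "i \<in> I" "k \<in> I" for i k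
    using nonneg[of "f i - f k"] assms(2) that by (simp add: bilinear mem commute field_simps)
  then have "(\<Sum>i\<in>I. \<Sum>k\<in>I. a (f k) (f i))
      \<le> (\<Sum>i\<in>I. \<Sum>k\<in>I. (a (f i) (f i) + a (f k) (f k)) / 2)"
    by (intro sum_mono)
  also have "\<dots> = real (card I) * (\<Sum>i\<in>I. a (f i) (f i))"
    by (simp add: sum.distrib add_divide_distrib sum_distrib_left flip: sum_divide_distrib)
  finally show ?thesis
    using assms by (simp add: sum_left sum_right mem)
qed

text \<open>The gap between the two sides is the energy of \<open>h + e\<close>.\<close>

lemma energy_off_orthogonal_part:
  assumes V: "h \<in> V" "e \<in> V" "z \<in> V" and orth: "a h z = 0"
  shows "a (e + z) (e + z) \<le> a (h + e + z) (h + e + z) + a e e"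
  using nonneg[of "h + e"] V orth commute[of z h] commute[of z e] commute[of e h]
  by (simp add: bilinear mem)

text \<open>
  Gram-Schmidt: a new generator is replaced by its component orthogonal to the old span.  If that
  component is null, then it is orthogonal to everything and the old projection still works.
\<close>

lemma projection_exists:
  assumes "finite B" "B \<subseteq> V" "v \<in> V"
  shows "\<exists>q\<in>span B. \<forall>z\<in>span B. a q z = a v z"
  using assms
proof (induction B arbitrary: v rule: finite_induct)
  case empty
  then show ?case by (auto simp: zero_right zero_left mem)
next
  case (insert b B)
  have sub: "span B \<subseteq> V" using insert.prems by (intro span_minimal subspace) simp
  obtain pb where pb: "pb \<in> span B" "\<And>z. z \<in> span B \<Longrightarrow> a pb z = a b z"
    using insert.IH[of b] insert.prems by auto
  obtain q where q: "q \<in> span B" "\<And>z. z \<in> span B \<Longrightarrow> a q z = a v z"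
    using insert.IH[of v] insert.prems by auto
  define b' where "b' = b - pb"
  have inV: "b \<in> V" "pb \<in> V" "q \<in> V" "v \<in> V" "b' \<in> V"
    using insert.prems pb(1) q(1) sub by (auto simp: b'_def mem)
  have b'_orth: "a b' z = 0" if "z \<in> span B" for z
    using that sub inV pb by (auto simp: b'_def diff_left)
  define s where "s = (if a b' b' = 0 then 0 else a v b' / a b' b')"
  define q' where "q' = q + s *\<^sub>R b'"
  have b'_span: "b' \<in> span (insert b B)"
    unfolding b'_def by (meson insertCI pb(1) span_base span_diff span_mono subset_insertI subsetD)
  have q'_span: "q' \<in> span (insert b B)"
    unfolding q'_def by (meson b'_span q(1) span_add span_mono span_scale subset_insertI subsetD)
  have q'V: "q' \<in> V" using inV by (auto simp: q'_def mem)
  have on_b': "a q' b' = a v b'"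
  proof (cases "a b' b' = 0")
    case True
    then show ?thesis using orthogonal_null[of q' b'] orthogonal_null[of v b'] inV q'V by simp
  next
    case False
    then show ?thesis
      using inV b'_orth[OF q(1)] commute[of q b'] by (simp add: q'_def s_def bilinear mem)
  qed
  have "a q' z = a v z" if z: "z \<in> span (insert b B)" for z
  proof -
    obtain c where c: "z - c *\<^sub>R b \<in> span B" using z unfolding span_insert by auto
    define z0 where "z0 = (z - c *\<^sub>R b) + c *\<^sub>R pb"
    have z0: "z0 \<in> span B" unfolding z0_def using c pb(1) by (intro span_add span_scale)
    then have z0V: "z0 \<in> V" using sub by auto
    have z_eq: "z = z0 + c *\<^sub>R b'" by (simp add: z0_def b'_def algebra_simps)
    have "a q' z0 = a v z0"
      using q(2)[OF z0] b'_orth[OF z0] inV z0V by (simp add: q'_def bilinear mem)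
    then show ?thesis unfolding z_eq using on_b' inV z0V q'V by (simp add: bilinear mem)
  qed
  with q'_span show ?case by blast
qed

text \<open>
  Definiteness on the subspace gives uniqueness, which makes the definite description in
  the definition of \<open>form_proj\<close> denote the projection.
\<close>

lemma form_proj:
  assumes W: "subspace W" "W \<subseteq> V" "finite B" "W \<subseteq> span B"
    and definite: "\<And>z. \<lbrakk>z \<in> W; a z z = 0\<rbrakk> \<Longrightarrow> z = 0" and v: "v \<in> V"
  shows "form_proj a W v \<in> W" "\<And>z. z \<in> W \<Longrightarrow> a (form_proj a W v) z = a v z"
proof -
  obtain C where C: "C \<subseteq> W" "independent C" "W \<subseteq> span C" by (rule maximal_independent_subset)
  then have "finite C" using independent_span_bound[of B C] W by auto
  moreover have spanC: "span C = W" using C W(1) by (simp add: span_minimal subset_antisym)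
  ultimately obtain q where q: "q \<in> W" "\<forall>z\<in>W. a q z = a v z"
    using projection_exists[of C v] C(1) W(2) v by auto
  have "q' = q" if q': "q' \<in> W" "\<forall>z\<in>W. a q' z = a v z" for q'
  proof -
    have "q' - q \<in> W" using q(1) q'(1) W(1) by (simp add: subspace_diff)
    then have "a (q' - q) (q' - q) = 0"
      using q q' W(2) by (subst diff_left) auto
    with \<open>q' - q \<in> W\<close> have "q' - q = 0" by (rule definite)
    then show ?thesis by simp
  qed
  then have "form_proj a W v = q"
    unfolding form_proj_def using q by (intro the_equality) blast+
  then show "form_proj a W v \<in> W" "\<And>z. z \<in> W \<Longrightarrow> a (form_proj a W v) z = a v z"
    using q by auto
qed

text \<open>
  With \<open>e\<close> for the sum of the \<open>q j\<close>, the number \<open>a e v\<close> is the sum of their energies, so that the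
  Cauchy-Schwarz inequality reads \<open>(a e v)\<^sup>2 \<le> a e e * a v v \<le> c * a e v * a v v\<close>.
\<close>

lemma subspace_correction_bound_above:
  assumes J: "finite J" and v: "v \<in> V"
    and q: "\<And>j. j \<in> J \<Longrightarrow> q j \<in> V" "\<And>j. j \<in> J \<Longrightarrow> a (q j) v = a (q j) (q j)"
    and strengthened: "a (\<Sum>j\<in>J. q j) (\<Sum>j\<in>J. q j) \<le> c * (\<Sum>j\<in>J. a (q j) (q j))"
    and "0 \<le> c"
  shows "a (\<Sum>j\<in>J. q j) v \<le> c * a v v"
proof -
  define e where "e = (\<Sum>j\<in>J. q j)"
  have e: "e \<in> V" using q by (auto simp: e_def mem)
  have ev: "a e v = (\<Sum>j\<in>J. a (q j) (q j))" unfolding e_def using q v by (simp add: sum_left)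
  have "(a e v)\<^sup>2 \<le> a e e * a v v" by (rule Cauchy_Schwarz[OF e v])
  also have "\<dots> \<le> (c * a e v) * a v v"
    using strengthened nonneg[OF v] unfolding ev by (intro mult_right_mono) (simp_all add: e_def)
  finally have sq: "a e v * a e v \<le> a e v * (c * a v v)" by (simp add: power2_eq_square algebra_simps)
  show ?thesis
  proof (cases "a e v = 0")
    case True
    then show ?thesis using nonneg[OF v] \<open>0 \<le> c\<close> by (simp add: e_def)
  next
    case False
    moreover have "0 \<le> a e v" unfolding ev using q(1) by (intro sum_nonneg nonneg)
    ultimately have "0 < a e v" by simp
    then show ?thesis using sq by (simp add: e_def)
  qed
qed

text \<open>
  The lower bound is the duality between the decomposition of \<open>v\<close> and the projections of \<open>v\<close>:
  \<open>a v v = \<Sum> a v (w j) = \<Sum> a (q j) (w j)\<close>, and Young's inequality is applied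
  to each term of the last sum.
\<close>

lemma subspace_correction_bound_below:
  assumes J: "finite J" and v: "v \<in> V" "0 < a v v"
    and w: "\<And>j. j \<in> J \<Longrightarrow> w j \<in> V" "v = (\<Sum>j\<in>J. w j)"
    and stable: "(\<Sum>j\<in>J. a (w j) (w j)) \<le> C * a v v"
    and q: "\<And>j. j \<in> J \<Longrightarrow> q j \<in> V" "\<And>j. j \<in> J \<Longrightarrow> a (q j) v = a (q j) (q j)"
      "\<And>j. j \<in> J \<Longrightarrow> a (q j) (w j) = a v (w j)"
  shows "a v v \<le> C * a (\<Sum>j\<in>J. q j) v"
proof -
  define s where "s = (\<Sum>j\<in>J. a (q j) (q j))"
  have s: "a (\<Sum>j\<in>J. q j) v = s" using q v by (simp add: sum_left s_def)
  have s0: "0 \<le> s" using q by (simp add: s_def sum_nonneg nonneg)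
  have "a v v = (\<Sum>j\<in>J. a v (w j))"
    using sum_right[of J w v] w v by simp
  also have "\<dots> = (\<Sum>j\<in>J. a (q j) (w j))" using q by simp
  \<comment> \<open>The weight \<open>C\<close> makes the second sum absorbable: it becomes at most \<open>a v v / 2\<close>.\<close>
  also have "\<dots> \<le> (\<Sum>j\<in>J. (C / 2) * a (q j) (q j) + a (w j) (w j) / (2 * C))" if "0 < C"
  proof (rule sum_mono)
    fix j assume j: "j \<in> J"
    have "0 \<le> a (C *\<^sub>R q j - w j) (C *\<^sub>R q j - w j)" using j q w by (intro nonneg) (simp add: mem)
    then have "2 * C * a (q j) (w j) \<le> C\<^sup>2 * a (q j) (q j) + a (w j) (w j)"
      using j q(1) w(1) commute[of "q j" "w j"] by (simp add: bilinear mem power2_eq_square algebra_simps)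
    then show "a (q j) (w j) \<le> (C / 2) * a (q j) (q j) + a (w j) (w j) / (2 * C)"
      using that by (simp add: field_simps power2_eq_square)
  qed
  finally have le: "a v v \<le> (C / 2) * s + (\<Sum>j\<in>J. a (w j) (w j)) / (2 * C)" if "0 < C"
    using that by (simp add: sum.distrib s_def sum_distrib_left sum_divide_distrib)
  \<comment> \<open>If \<open>C \<le> 0\<close>, then all \<open>w j\<close> are null, and then so is \<open>v\<close>.\<close>
  have "0 < C"
  proof (rule ccontr)
    assume "\<not> 0 < C"
    then have "(\<Sum>j\<in>J. a (w j) (w j)) \<le> 0" using stable v mult_nonpos_nonneg[of C "a v v"] by linarith
    moreover have "0 \<le> (\<Sum>j\<in>J. a (w j) (w j))" using w(1) by (intro sum_nonneg nonneg)
    ultimately have "(\<Sum>j\<in>J. a (w j) (w j)) = 0" by simp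
    then have "a (w j) (w j) = 0" if "j \<in> J" for j
      using that J w(1) by (subst (asm) sum_nonneg_eq_0_iff) (auto intro: nonneg)
    then have "(\<Sum>j\<in>J. a v (w j)) = 0" using w v by (intro sum.neutral) (auto simp: orthogonal_null)
    with \<open>a v v = (\<Sum>j\<in>J. a v (w j))\<close> v show False by simp
  qed
  moreover from this have "(\<Sum>j\<in>J. a (w j) (w j)) / (2 * C) \<le> a v v / 2"
    using stable by (simp add: field_simps)
  ultimately show ?thesis using le s by simp
qed

end

section \<open>Truncated eigenexpansions\<close>

text \<open>
  The \<open>c k\<close> are the coefficients of \<open>v\<close> in the basis of eigenvectors.  The eigenvectors with finite
  eigenvalue are orthogonal for \<open>a\<close> and for the form \<open>b x y = a (\<eta> x) (\<eta> y)\<close>; those with infinite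
  eigenvalue are \<open>a\<close>-orthogonal to them and in the kernel of \<open>b\<close>.  Hence \<open>b r r\<close> is the sum of
  \<open>(c k)\<^sup>2\<close> over the finite eigenvalues beyond the first \<open>m\<close>, while \<open>a v v\<close> is at least the same sum
  with weights \<open>lam k \<ge> lam (m + 1)\<close>.
\<close>

lemma (in semi_inner) eigensystem_truncation:
  assumes \<eta>: "lin_on V \<eta>" "\<And>v. v \<in> V \<Longrightarrow> \<eta> v \<in> V"
    and eig: "eigensystem a \<eta> V lam t"
    and m: "m + 1 \<le> dim V" "0 < lam (m + 1)" "lam (m + 1) < \<infinity>"
    and v: "v \<in> V"
  shows "\<exists>c. let r = v - (\<Sum>k\<in>{1..m}. c k *\<^sub>R t k) in
    a (\<eta> r) (\<eta> r) \<le> a v v / real_of_ereal (lam (m + 1))"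
proof -
  define K where "K = {1..dim V}"
  have bas: "basis_on K t V" and lam0: "\<And>k. k \<in> K \<Longrightarrow> 0 \<le> lam k"
    and inf: "\<And>k u. \<lbrakk>k \<in> K; lam k = \<infinity>; u \<in> V\<rbrakk> \<Longrightarrow> a (\<eta> u) (\<eta> (t k)) = 0"
    and fin: "\<And>k u. \<lbrakk>k \<in> K; lam k \<noteq> \<infinity>; u \<in> V\<rbrakk> \<Longrightarrow>
      a u (t k) = real_of_ereal (lam k) * a (\<eta> u) (\<eta> (t k))"
    and mono: "\<And>k l. \<lbrakk>k \<in> K; l \<in> K; k \<le> l\<rbrakk> \<Longrightarrow> lam k \<le> lam l"
    and orth: "\<And>k l. \<lbrakk>k \<in> K; l \<in> K; lam k \<noteq> \<infinity>; lam l \<noteq> \<infinity>\<rbrakk> \<Longrightarrow>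
      a (\<eta> (t k)) (\<eta> (t l)) = (if k = l then 1 else 0)"
    using eig unfolding eigensystem_def K_def by (auto split: if_splits)
  have finK: "finite K" by (simp add: K_def)
  have tV: "t k \<in> V" if "k \<in> K" for k
    using bas that by (auto simp: basis_on_def intro: span_base)
  have "v \<in> span (t ` K)" using bas v by (simp add: basis_on_def)
  then obtain d where "v = (\<Sum>x\<in>t ` K. d x *\<^sub>R x)" using finK by (auto simp: span_finite)
  then have v_eq: "v = (\<Sum>k\<in>K. d (t k) *\<^sub>R t k)"
    using bas by (simp add: basis_on_def sum.reindex)
  define c where "c k = d (t k)" for k
  define r where "r = v - (\<Sum>k\<in>{1..m}. c k *\<^sub>R t k)"
  define F where "F = {k\<in>K. lam k \<noteq> \<infinity>}"
  define I where "I = {k\<in>K. lam k = \<infinity>}"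
  define R where "R = {k\<in>K. m < k}"
  have sub: "F \<subseteq> K" "I \<subseteq> K" "R \<subseteq> K" "F \<inter> I = {}" "K = F \<union> I" "finite F" "finite I" "finite R"
    using finK by (auto simp: F_def I_def R_def)
  have r_eq: "r = (\<Sum>k\<in>R. c k *\<^sub>R t k)"
  proof -
    have "K = {1..m} \<union> R" "{1..m} \<inter> R = {}" using m(1) by (auto simp: K_def R_def)
    then show ?thesis using sub by (simp add: r_def v_eq sum.union_disjoint c_def)
  qed
  have \<eta>_add: "\<eta> (x + y) = \<eta> x + \<eta> y" if "x \<in> V" "y \<in> V" for x y
    using \<eta>(1) that by (simp add: lin_on_def)
  have \<eta>_scale: "\<eta> (s *\<^sub>R x) = s *\<^sub>R \<eta> x" if "x \<in> V" for s x
    using \<eta>(1) that by (simp add: lin_on_def)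
  interpret b: semi_inner V "\<lambda>x y. a (\<eta> x) (\<eta> y)"
    using subspace by unfold_locales
      (auto simp: \<eta> \<eta>_add \<eta>_scale add_left scale_left psd_on_def symmetric_on_def nonneg commute)
  have b_tt: "a (\<eta> (t k)) (\<eta> (t l)) = (if k = l \<and> lam k \<noteq> \<infinity> then 1 else 0)"
    if "k \<in> K" "l \<in> K" for k l
    using that inf[of l "t k"] inf[of k "t l"] b.commute[of "t k" "t l"] orth[of k l] tV
    by (cases "lam k = \<infinity>"; cases "lam l = \<infinity>") auto
  have ctV: "c k *\<^sub>R t k \<in> V" if "k \<in> K" for k using that tV by (simp add: mem)
  have "a (\<eta> r) (\<eta> r) = (\<Sum>k\<in>R. \<Sum>l\<in>R. c k * c l * a (\<eta> (t k)) (\<eta> (t l)))"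
    unfolding r_eq using sub tV by (intro b.sum_sum) auto
  also have "\<dots> = (\<Sum>k\<in>R. \<Sum>l\<in>R. if k = l then (if lam k \<noteq> \<infinity> then (c k)\<^sup>2 else 0) else 0)"
    using sub by (intro sum.cong refl) (auto simp: b_tt subset_eq power2_eq_square)
  also have "\<dots> = (\<Sum>k\<in>R. if lam k \<noteq> \<infinity> then (c k)\<^sup>2 else 0)"
    using sub by (intro sum.cong refl) simp
  also have "\<dots> = (\<Sum>k\<in>R \<inter> F. (c k)\<^sup>2)"
    using sub(8) by (subst sum.inter_restrict) (auto simp: F_def R_def intro!: sum.cong)
  finally have b_r: "a (\<eta> r) (\<eta> r) = (\<Sum>k\<in>R \<inter> F. (c k)\<^sup>2)" .
  define f where "f = (\<Sum>k\<in>F. c k *\<^sub>R t k)"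
  define w where "w = (\<Sum>k\<in>I. c k *\<^sub>R t k)"
  have fwV: "f \<in> V" "w \<in> V" unfolding f_def w_def using ctV sub by (auto intro!: mem(5))
  have v_fw: "v = w + f" using sub by (simp add: v_eq f_def w_def sum.union_disjoint c_def)
  \<comment> \<open>Besides orthogonality within \<open>F\<close>, this gives \<open>a\<close>-orthogonality of \<open>I\<close> to \<open>F\<close>.\<close>
  have a_tt: "a (t l) (t k) = (if k = l then real_of_ereal (lam k) else 0)"
    if "k \<in> F" "l \<in> K" for k l
    using that fin[of k "t l"] b_tt[of l k] tV by (auto simp: F_def)
  have "a w f = (\<Sum>l\<in>I. \<Sum>k\<in>F. c l * c k * a (t l) (t k))"
    unfolding w_def f_def using sub tV by (intro sum_sum) auto
  also have "\<dots> = 0" using sub by (intro sum.neutral ballI) (auto simp: a_tt)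
  finally have wf: "a w f = 0" .
  have "a f f = (\<Sum>l\<in>F. \<Sum>k\<in>F. c l * c k * a (t l) (t k))"
    unfolding f_def using sub tV by (intro sum_sum) auto
  also have "\<dots> = (\<Sum>l\<in>F. \<Sum>k\<in>F. if l = k then real_of_ereal (lam l) * (c l)\<^sup>2 else 0)"
    using sub by (intro sum.cong refl) (auto simp: a_tt subset_eq power2_eq_square)
  also have "\<dots> = (\<Sum>k\<in>F. real_of_ereal (lam k) * (c k)\<^sup>2)"
    using sub by (intro sum.cong refl) simp
  finally have ff: "a f f = (\<Sum>k\<in>F. real_of_ereal (lam k) * (c k)\<^sup>2)" .
  have pos: "0 < real_of_ereal (lam (m + 1))"
    using m by (cases "lam (m + 1)") auto
  have "real_of_ereal (lam (m + 1)) * (\<Sum>k\<in>R \<inter> F. (c k)\<^sup>2) \<le> (\<Sum>k\<in>R \<inter> F. real_of_ereal (lam k) * (c k)\<^sup>2)"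
    unfolding sum_distrib_left
  proof (intro sum_mono mult_right_mono)
    fix k assume k: "k \<in> R \<inter> F"
    then have "lam (m + 1) \<le> lam k" using m by (intro mono) (auto simp: R_def F_def K_def)
    then show "real_of_ereal (lam (m + 1)) \<le> real_of_ereal (lam k)"
      using k m by (intro real_of_ereal_positive_mono) (auto simp: F_def)
  qed simp
  also have "\<dots> \<le> a f f"
    unfolding ff using sub lam0 by (intro sum_mono2) (auto simp: real_of_ereal_pos)
  also have "\<dots> \<le> a v v"
    unfolding v_fw using fwV wf commute[of w f] nonneg[of w]
    by (simp add: add_left add_right mem(1))
  finally have "real_of_ereal (lam (m + 1)) * a (\<eta> r) (\<eta> r) \<le> a v v" unfolding b_r .
  then have "a (\<eta> r) (\<eta> r) \<le> a v v / real_of_ereal (lam (m + 1))"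
    using pos by (simp add: field_simps)
  then show ?thesis unfolding Let_def r_def by blast
qed

section \<open>Matrix representation of subspace corrections\<close>

definition lin_comb :: "nat \<Rightarrow> (nat \<Rightarrow> 'a::real_vector) \<Rightarrow> real Matrix.vec \<Rightarrow> 'a"
  where "lin_comb n \<phi> x = (\<Sum>i<n. vec_index x i *\<^sub>R \<phi> i)"

lemma lin_comb_add:
  "\<lbrakk>x \<in> carrier_vec n; y \<in> carrier_vec n\<rbrakk> \<Longrightarrow> lin_comb n \<phi> (x + y) = lin_comb n \<phi> x + lin_comb n \<phi> y"
  by (simp add: lin_comb_def scaleR_left_distrib sum.distrib)

lemma lin_comb_smult:
  "x \<in> carrier_vec n \<Longrightarrow> lin_comb n \<phi> (c \<cdot>\<^sub>v x) = c *\<^sub>R lin_comb n \<phi> x"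
  by (simp add: lin_comb_def scaleR_right.sum)

lemma lin_comb_mem:
  assumes "subspace W" "\<And>i. i < n \<Longrightarrow> \<phi> i \<in> W"
  shows "lin_comb n \<phi> x \<in> W"
  unfolding lin_comb_def using assms by (intro subspace_sum subspace_scale) auto

lemma lin_comb_eq_0:
  assumes "basis_on {..<n} \<phi> V" "x \<in> carrier_vec n" "lin_comb n \<phi> x = 0"
  shows "x = 0\<^sub>v n"
proof -
  have inj: "inj_on \<phi> {..<n}" and ind: "independent (\<phi> ` {..<n})"
    using assms by (auto simp: basis_on_def)
  define f where "f b = vec_index x (the_inv_into {..<n} \<phi> b)" for b
  have "(\<Sum>b\<in>\<phi> ` {..<n}. f b *\<^sub>R b) = lin_comb n \<phi> x"
    unfolding lin_comb_def using inj
    by (subst sum.reindex) (auto simp: f_def the_inv_into_f_f intro!: sum.cong)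
  then have "f (\<phi> i) = 0" if "i < n" for i
    using ind assms(3) that by (auto simp: dependent_finite)
  then have "vec_index x i = 0" if "i < n" for i
    using that inj by (force simp: f_def the_inv_into_f_f)
  then show ?thesis using assms(2) by auto
qed

lemma lin_comb_surj:
  assumes "basis_on {..<n} \<phi> V" "v \<in> V"
  shows "\<exists>x\<in>carrier_vec n. v = lin_comb n \<phi> x"
proof -
  have "v \<in> span (\<phi> ` {..<n})" using assms by (simp add: basis_on_def)
  then obtain d where "v = (\<Sum>b\<in>\<phi> ` {..<n}. d b *\<^sub>R b)" by (auto simp: span_finite)
  also have "\<dots> = lin_comb n \<phi> (Matrix.vec n (\<lambda>i. d (\<phi> i)))"
    using assms by (simp add: lin_comb_def basis_on_def sum.reindex)
  finally show ?thesis by (intro bexI[of _ "Matrix.vec n (\<lambda>i. d (\<phi> i))"]) auto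
qed

lemma mult_mat_vec_index:
  assumes "B \<in> carrier_mat n p" "w \<in> carrier_vec p" "i < n"
  shows "vec_index (B *\<^sub>v w) i = (\<Sum>l<p. B $$ (i, l) * vec_index w l)"
  using assms by (simp add: scalar_prod_def atLeast0LessThan)

lemma embedding_mat_carrier: "embedding_mat n \<phi> p \<psi> \<in> carrier_mat n p"
  by (simp add: embedding_mat_def)

lemma lin_comb_embedding_mat:
  assumes \<phi>: "basis_on {..<n} \<phi> V" and \<psi>: "\<And>l. l < p \<Longrightarrow> \<psi> l \<in> V" and w: "w \<in> carrier_vec p"
  shows "lin_comb n \<phi> (embedding_mat n \<phi> p \<psi> *\<^sub>v w) = lin_comb p \<psi> w"
proof -
  let ?r = "\<lambda>l i. representation (\<phi> ` {..<n}) (\<psi> l) (\<phi> i)"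
  have rep: "(\<Sum>i<n. ?r l i *\<^sub>R \<phi> i) = \<psi> l" if "l < p" for l
  proof -
    have "(\<Sum>b\<in>\<phi> ` {..<n}. representation (\<phi> ` {..<n}) (\<psi> l) b *\<^sub>R b) = \<psi> l"
      using \<phi> \<psi>[OF that] by (intro real_vector.sum_representation_eq) (auto simp: basis_on_def)
    then show ?thesis using \<phi> by (simp add: basis_on_def sum.reindex)
  qed
  have "lin_comb n \<phi> (embedding_mat n \<phi> p \<psi> *\<^sub>v w)
      = (\<Sum>i<n. (\<Sum>l<p. ?r l i * vec_index w l) *\<^sub>R \<phi> i)"
    unfolding lin_comb_def
    by (intro sum.cong refl) (simp add: mult_mat_vec_index[OF embedding_mat_carrier w], simp add: embedding_mat_def)
  also have "\<dots> = (\<Sum>l<p. vec_index w l *\<^sub>R (\<Sum>i<n. ?r l i *\<^sub>R \<phi> i))"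
    by (simp add: scaleR_left.sum scaleR_right.sum mult.commute sum.swap[of _ "{..<p}"])
  also have "\<dots> = lin_comb p \<psi> w" by (simp add: rep lin_comb_def)
  finally show ?thesis .
qed

context semi_inner
begin

lemma stiffness_mat_form:
  assumes \<phi>: "\<And>i. i < n \<Longrightarrow> \<phi> i \<in> V" and x: "x \<in> carrier_vec n" and y: "y \<in> carrier_vec n"
  shows "(stiffness_mat a n \<phi> *\<^sub>v x) \<bullet> y = a (lin_comb n \<phi> x) (lin_comb n \<phi> y)"
proof -
  have A: "stiffness_mat a n \<phi> \<in> carrier_mat n n" by (simp add: stiffness_mat_def)
  have "(stiffness_mat a n \<phi> *\<^sub>v x) \<bullet> y
      = (\<Sum>i<n. (\<Sum>k<n. a (\<phi> k) (\<phi> i) * vec_index x k) * vec_index y i)"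
    using y by (simp add: scalar_prod_def[of _ y] atLeast0LessThan mult_mat_vec_index[OF A x] del: index_mult_mat_vec)
      (simp add: stiffness_mat_def)
  also have "\<dots> = (\<Sum>k<n. \<Sum>i<n. vec_index x k * vec_index y i * a (\<phi> k) (\<phi> i))"
    unfolding sum_distrib_right by (subst sum.swap) (simp add: mult_ac)
  also have "\<dots> = a (lin_comb n \<phi> x) (lin_comb n \<phi> y)"
    unfolding lin_comb_def using \<phi> by (subst sum_sum) auto
  finally show ?thesis .
qed

text \<open>
  In coordinates the Galerkin matrix is \<open>R A R\<^sup>T\<close>, so the correction is the function in the subspace
  whose energy products with the subspace agree with those of the argument.
\<close>

lemma subspace_correction_projects:
  assumes definite: "\<And>v. \<lbrakk>v \<in> V; a v v = 0\<rbrakk> \<Longrightarrow> v = 0"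
    and \<phi>: "basis_on {..<n} \<phi> V" and \<psi>: "basis_on {..<p} \<psi> W" and W: "W \<subseteq> V"
    and x: "x \<in> carrier_vec n"
  defines "A \<equiv> stiffness_mat a n \<phi>" and "RT \<equiv> embedding_mat n \<phi> p \<psi>"
  defines "q \<equiv> lin_comb n \<phi> (subspace_correction A RT *\<^sub>v (A *\<^sub>v x))"
  shows "subspace_correction A RT \<in> carrier_mat n n"
    and "q \<in> W" and "\<And>z. z \<in> W \<Longrightarrow> a q z = a (lin_comb n \<phi> x) z"
proof -
  have \<phi>V: "\<phi> i \<in> V" if "i < n" for i
    using \<phi> that by (auto simp: basis_on_def intro: span_base)
  have \<psi>W: "\<psi> i \<in> W" if "i < p" for i
    using \<psi> that by (auto simp: basis_on_def intro: span_base)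
  have \<psi>V: "\<psi> i \<in> V" if "i < p" for i using \<psi>W W that by auto
  have W_sub: "subspace W" using \<psi> by (auto simp: basis_on_def)
  have A: "A \<in> carrier_mat n n" by (simp add: A_def stiffness_mat_def)
  have RT: "RT \<in> carrier_mat n p" by (simp add: RT_def embedding_mat_carrier)
  define G where "G = transpose_mat RT * A * RT"
  have G: "G \<in> carrier_mat p p" using A RT by (simp add: G_def)
  have emb: "lin_comb n \<phi> (RT *\<^sub>v w) = lin_comb p \<psi> w" if "w \<in> carrier_vec p" for w
    unfolding RT_def using that \<phi> \<psi>V by (intro lin_comb_embedding_mat) auto
  have RT_form: "(transpose_mat RT *\<^sub>v (A *\<^sub>v y)) \<bullet> w = a (lin_comb n \<phi> y) (lin_comb p \<psi> w)"
    if y: "y \<in> carrier_vec n" and w: "w \<in> carrier_vec p" for y w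
  proof -
    have "(transpose_mat RT *\<^sub>v (A *\<^sub>v y)) \<bullet> w = (A *\<^sub>v y) \<bullet> (RT *\<^sub>v w)"
      using A RT y w by (intro transpose_vec_mult_scalar[of _ n p]) auto
    also have "\<dots> = a (lin_comb n \<phi> y) (lin_comb n \<phi> (RT *\<^sub>v w))"
      unfolding A_def using RT y w \<phi>V by (intro stiffness_mat_form) auto
    finally show ?thesis using emb[OF w] by simp
  qed
  have G_mult: "G *\<^sub>v w = transpose_mat RT *\<^sub>v (A *\<^sub>v (RT *\<^sub>v w))" if "w \<in> carrier_vec p" for w
    using that A RT by (simp add: G_def assoc_mult_mat_vec[of _ p n _ p] assoc_mult_mat_vec[of _ p n _ n])
  have G_form: "(G *\<^sub>v w) \<bullet> w' = a (lin_comb p \<psi> w) (lin_comb p \<psi> w')"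
    if "w \<in> carrier_vec p" "w' \<in> carrier_vec p" for w w'
    using that RT RT_form[of "RT *\<^sub>v w" w'] emb[of w] by (simp add: G_mult)
  have "Determinant.det G \<noteq> 0"
  proof
    assume "Determinant.det G = 0"
    then obtain w where w: "w \<in> carrier_vec p" "w \<noteq> 0\<^sub>v p" "G *\<^sub>v w = 0\<^sub>v p"
      using det_0_iff_vec_prod_zero[OF G] by auto
    then have "a (lin_comb p \<psi> w) (lin_comb p \<psi> w) = 0"
      using G_form[of w w] by simp
    moreover have "lin_comb p \<psi> w \<in> V" by (intro lin_comb_mem subspace \<psi>V)
    ultimately have "lin_comb p \<psi> w = 0" by (intro definite)
    then show False using lin_comb_eq_0[OF \<psi> w(1)] w(2) by simp
  qed
  then have "G \<in> Units (ring_mat TYPE(real) p ())" by (rule det_non_zero_imp_unit[OF G])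
  then obtain B where inv: "mat_inverse G = Some B" using mat_inverse(1)[OF G, where b = "()"] by (cases "mat_inverse G") auto
  then have B: "G * B = 1\<^sub>m p" "B \<in> carrier_mat p p" using mat_inverse(2)[OF G inv] by auto
  have sc: "subspace_correction A RT = RT * B * transpose_mat RT"
    using inv by (simp add: subspace_correction_def G_def)
  then show "subspace_correction A RT \<in> carrier_mat n n" using RT B by simp
  define g where "g = transpose_mat RT *\<^sub>v (A *\<^sub>v x)"
  define w where "w = B *\<^sub>v g"
  have g: "g \<in> carrier_vec p" using RT A x by (simp add: g_def)
  have w: "w \<in> carrier_vec p" using B g by (simp add: w_def)
  have "subspace_correction A RT *\<^sub>v (A *\<^sub>v x) = RT *\<^sub>v w"
    unfolding sc w_def g_def using RT B A x
    by (simp add: assoc_mult_mat_vec[of _ n p _ n] assoc_mult_mat_vec[of _ n p _ p])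
  then have q_eq: "q = lin_comb p \<psi> w" using emb[OF w] by (simp add: q_def)
  then show "q \<in> W" using lin_comb_mem[OF W_sub \<psi>W] by simp
  have Gw: "G *\<^sub>v w = g"
    unfolding w_def using assoc_mult_mat_vec[OF G B(2) g] B(1) g by simp
  fix z assume "z \<in> W"
  then obtain w' where w': "w' \<in> carrier_vec p" "z = lin_comb p \<psi> w'" using lin_comb_surj[OF \<psi>] by auto
  have "a q z = (G *\<^sub>v w) \<bullet> w'" using G_form[OF w w'(1)] by (simp add: q_eq w'(2))
  also have "\<dots> = a (lin_comb n \<phi> x) z" unfolding Gw g_def using RT_form[OF x w'(1)] w'(2) by simp
  finally show "a q z = a (lin_comb n \<phi> x) z" .
qed

text \<open>
  A complex eigenvalue \<open>s + \<i> t\<close> exists.  If \<open>x + \<i> y\<close> is an eigenvector for it, then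
  \<open>B x = s x - t y\<close> and \<open>B y = s y + t x\<close>, and self-adjointness turns this into
  \<open>t (a x x + a y y) = 0\<close>.
\<close>

lemma self_adjoint_real_eigenvalue:
  assumes definite: "\<And>v. \<lbrakk>v \<in> V; a v v = 0\<rbrakk> \<Longrightarrow> v = 0"
    and \<phi>: "basis_on {..<n} \<phi> V" and n: "0 < n" and B: "B \<in> carrier_mat n n"
    and adj: "\<And>x y. \<lbrakk>x \<in> carrier_vec n; y \<in> carrier_vec n\<rbrakk> \<Longrightarrow>
      a (lin_comb n \<phi> (B *\<^sub>v x)) (lin_comb n \<phi> y) = a (lin_comb n \<phi> x) (lin_comb n \<phi> (B *\<^sub>v y))"
  shows "\<exists>k. eigenvalue B k"
proof -
  let ?B = "map_mat complex_of_real B"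
  have B': "?B \<in> carrier_mat n n" using B by simp
  have "degree (char_poly ?B) = n" using degree_monic_char_poly[OF B'] by simp
  then have "\<not> constant (poly (char_poly ?B))" using n by (simp add: constant_degree)
  then obtain \<mu> where "poly (char_poly ?B) \<mu> = 0" using fundamental_theorem_of_algebra by blast
  then have "eigenvalue ?B \<mu>" using eigenvalue_root_char_poly[OF B'] by simp
  then obtain z where z: "z \<in> carrier_vec n" "z \<noteq> 0\<^sub>v n" "?B *\<^sub>v z = \<mu> \<cdot>\<^sub>v z"
    using B by (auto simp: eigenvalue_def eigenvector_def)
  define x where "x = map_vec Re z"
  define y where "y = map_vec Im z"
  define s where "s = Re \<mu>"
  define t where "t = Im \<mu>"
  have xy: "x \<in> carrier_vec n" "y \<in> carrier_vec n" using z by (auto simp: x_def y_def)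
  have row: "(\<Sum>l<n. complex_of_real (B $$ (i, l)) * vec_index z l) = \<mu> * vec_index z i" if "i < n" for i
  proof -
    have "vec_index (?B *\<^sub>v z) i = \<mu> * vec_index z i" using that z by simp
    then show ?thesis
      using that B mult_mat_vec_index[OF B' z(1) that] by (simp del: index_mult_mat_vec)
  qed
  have Bx: "B *\<^sub>v x = s \<cdot>\<^sub>v x + (- t) \<cdot>\<^sub>v y"
  proof (rule eq_vecI)
    fix i assume "i < dim_vec (s \<cdot>\<^sub>v x + (- t) \<cdot>\<^sub>v y)"
    then have i: "i < n" using xy by simp
    have "vec_index (B *\<^sub>v x) i = Re (\<Sum>l<n. complex_of_real (B $$ (i, l)) * vec_index z l)"
      unfolding mult_mat_vec_index[OF B xy(1) i] using z by (simp add: x_def)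
    then show "vec_index (B *\<^sub>v x) i = vec_index (s \<cdot>\<^sub>v x + (- t) \<cdot>\<^sub>v y) i"
      using i z xy by (simp add: row x_def y_def s_def t_def del: index_mult_mat_vec)
  qed (use B xy in auto)
  have By: "B *\<^sub>v y = s \<cdot>\<^sub>v y + t \<cdot>\<^sub>v x"
  proof (rule eq_vecI)
    fix i assume "i < dim_vec (s \<cdot>\<^sub>v y + t \<cdot>\<^sub>v x)"
    then have i: "i < n" using xy by simp
    have "vec_index (B *\<^sub>v y) i = Im (\<Sum>l<n. complex_of_real (B $$ (i, l)) * vec_index z l)"
      unfolding mult_mat_vec_index[OF B xy(2) i] using z by (simp add: y_def)
    then show "vec_index (B *\<^sub>v y) i = vec_index (s \<cdot>\<^sub>v y + t \<cdot>\<^sub>v x) i"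
      using i z xy by (simp add: row x_def y_def s_def t_def del: index_mult_mat_vec)
  qed (use B xy in auto)
  let ?c = "lin_comb n \<phi>"
  have cV: "?c v \<in> V" for v
    using \<phi> by (intro lin_comb_mem subspace) (auto simp: basis_on_def intro: span_base)
  have "a (?c (B *\<^sub>v x)) (?c y) = a (?c x) (?c (B *\<^sub>v y))" by (rule adj[OF xy])
  then have "t * (a (?c x) (?c x) + a (?c y) (?c y)) = 0"
    using xy cV unfolding Bx By
    by (simp add: lin_comb_add lin_comb_smult add_left add_right scale_left scale_right mem(2) algebra_simps
        del: scaleR_minus_left)
  moreover have "a (?c x) (?c x) + a (?c y) (?c y) \<noteq> 0"
  proof
    assume "a (?c x) (?c x) + a (?c y) (?c y) = 0"
    then have "a (?c x) (?c x) = 0" "a (?c y) (?c y) = 0"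
      using nonneg[OF cV, of x] nonneg[OF cV, of y] by auto
    then have "x = 0\<^sub>v n" "y = 0\<^sub>v n"
      using definite[OF cV] lin_comb_eq_0[OF \<phi>] xy by auto
    then have "vec_index z i = 0" if "i < n" for i
      using that z unfolding x_def y_def
      by (metis carrier_vecD complex_eq_iff index_map_vec(1) index_zero_vec(1) zero_complex.sel)
    then show False using z by auto
  qed
  ultimately have t: "t = 0" by simp
  have "x \<noteq> 0\<^sub>v n \<or> y \<noteq> 0\<^sub>v n"
  proof (rule ccontr)
    assume "\<not> ?thesis"
    then have "vec_index z i = 0" if "i < n" for i
      using that z unfolding x_def y_def
      by (metis carrier_vecD complex_eq_iff index_map_vec(1) index_zero_vec(1) zero_complex.sel)
    then show False using z by auto
  qed
  then have "eigenvector B x s \<or> eigenvector B y s"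
    using Bx By t xy B by (auto simp: eigenvector_def)
  then show ?thesis by (auto simp: eigenvalue_def)
qed

text \<open>
  In coordinates \<open>M * A\<close> is the sum of the energy projections onto the coarse space and the local
  spaces.  For an eigenvector \<open>v\<close> with eigenvalue \<open>e\<close>, the energy product of \<open>v\<close> with this sum is
  \<open>e * a v v\<close>, and the two bounds on sums of projections enclose \<open>e\<close> between \<open>1 / C\<close> and \<open>1 + k\<close>.
  The set of real eigenvalues is finite, and it is nonempty since \<open>M * A\<close> is self-adjoint for the
  energy product; so its maximum and minimum obey these bounds.
\<close>

theorem cond_number_two_level_AS_le:
  fixes k C :: real
  assumes definite: "\<And>v. \<lbrakk>v \<in> V; a v v = 0\<rbrakk> \<Longrightarrow> v = 0"
    and \<phi>: "basis_on {..<n} \<phi> V" and n: "0 < n"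
    and coarse: "basis_on {..<pH} \<psi>H W0" "W0 \<subseteq> V"
    and loc: "\<And>j. j \<in> {1..N} \<Longrightarrow> basis_on {..<p j} (\<psi> j) (W j)" "\<And>j. j \<in> {1..N} \<Longrightarrow> W j \<subseteq> V"
    and k: "0 \<le> k" and strengthened: "\<And>q. (\<And>j. j \<in> {1..N} \<Longrightarrow> q j \<in> W j) \<Longrightarrow>
      a (\<Sum>j\<in>{1..N}. q j) (\<Sum>j\<in>{1..N}. q j) \<le> k * (\<Sum>j\<in>{1..N}. a (q j) (q j))"
    and stable: "\<And>v. v \<in> V \<Longrightarrow> \<exists>w0\<in>W0. \<exists>w. (\<forall>j\<in>{1..N}. w j \<in> W j) \<and>
      v = w0 + (\<Sum>j\<in>{1..N}. w j) \<and> a w0 w0 + (\<Sum>j\<in>{1..N}. a (w j) (w j)) \<le> C * a v v"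
  defines "A \<equiv> stiffness_mat a n \<phi>"
  defines "M \<equiv> two_level_AS n A (embedding_mat n \<phi> pH \<psi>H) N (\<lambda>j. embedding_mat n \<phi> (p j) (\<psi> j))"
  shows "cond_number (M * A) \<le> (1 + k) * C"
proof -
  define S0 where "S0 = subspace_correction A (embedding_mat n \<phi> pH \<psi>H)"
  define S where "S j = subspace_correction A (embedding_mat n \<phi> (p j) (\<psi> j))" for j
  let ?c = "lin_comb n \<phi>"
  have \<phi>V: "\<phi> i \<in> V" if "i < n" for i
    using \<phi> that by (auto simp: basis_on_def intro: span_base)
  have cV: "?c x \<in> V" for x using \<phi>V by (intro lin_comb_mem subspace)
  have A: "A \<in> carrier_mat n n" by (simp add: A_def stiffness_mat_def)
  define q0 where "q0 x = ?c (S0 *\<^sub>v (A *\<^sub>v x))" for x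
  define q where "q j x = ?c (S j *\<^sub>v (A *\<^sub>v x))" for j x
  have S0: "S0 \<in> carrier_mat n n"
    unfolding S0_def A_def
    using subspace_correction_projects(1)[OF definite \<phi> coarse zero_carrier_vec] .
  have S: "S j \<in> carrier_mat n n" if "j \<in> {1..N}" for j
    unfolding S_def A_def
    using subspace_correction_projects(1)[OF definite \<phi> loc[OF that] zero_carrier_vec] .
  have q0: "q0 x \<in> W0" "\<And>z. z \<in> W0 \<Longrightarrow> a (q0 x) z = a (?c x) z" if "x \<in> carrier_vec n" for x
    using subspace_correction_projects(2,3)[OF definite \<phi> coarse that] by (auto simp: q0_def S0_def A_def)
  have q: "q j x \<in> W j" "\<And>z. z \<in> W j \<Longrightarrow> a (q j x) z = a (?c x) z"
    if "x \<in> carrier_vec n" "j \<in> {1..N}" for j x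
    using subspace_correction_projects(2,3)[OF definite \<phi> loc[OF that(2)] that(1)]
    by (auto simp: q_def S_def A_def)
  have M: "M \<in> carrier_mat n n" using S0 by (simp add: M_def two_level_AS_def S0_def)
  then have MA: "M * A \<in> carrier_mat n n" using A by simp
  have c_MA: "?c ((M * A) *\<^sub>v x) = q0 x + (\<Sum>j\<in>{1..N}. q j x)" if x: "x \<in> carrier_vec n" for x
  proof -
    have Ax: "A *\<^sub>v x \<in> carrier_vec n" using A x by simp
    have entry: "vec_index (M *\<^sub>v (A *\<^sub>v x)) i
        = vec_index (S0 *\<^sub>v (A *\<^sub>v x)) i + (\<Sum>j\<in>{1..N}. vec_index (S j *\<^sub>v (A *\<^sub>v x)) i)" if i: "i < n" for i
    proof -
      have "vec_index (M *\<^sub>v (A *\<^sub>v x)) i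
          = (\<Sum>l<n. (S0 $$ (i, l) + (\<Sum>j\<in>{1..N}. S j $$ (i, l))) * vec_index (A *\<^sub>v x) l)"
        unfolding mult_mat_vec_index[OF M Ax i]
        using i S0 by (intro sum.cong refl) (simp add: M_def two_level_AS_def S0_def S_def)
      also have "\<dots> = (\<Sum>l<n. S0 $$ (i, l) * vec_index (A *\<^sub>v x) l)
          + (\<Sum>j\<in>{1..N}. \<Sum>l<n. S j $$ (i, l) * vec_index (A *\<^sub>v x) l)"
        by (subst sum.swap) (simp add: distrib_right sum.distrib sum_distrib_right del: index_mult_mat_vec)
      finally show ?thesis
        using S by (simp add: mult_mat_vec_index[OF S0 Ax i] mult_mat_vec_index[OF S Ax i] del: index_mult_mat_vec)
    qed
    have "?c ((M * A) *\<^sub>v x) = ?c (M *\<^sub>v (A *\<^sub>v x))"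
      using assoc_mult_mat_vec[OF M A x] by simp
    also have "\<dots> = q0 x + (\<Sum>i<n. \<Sum>j\<in>{1..N}. vec_index (S j *\<^sub>v (A *\<^sub>v x)) i *\<^sub>R \<phi> i)"
      by (simp add: lin_comb_def entry q0_def scaleR_left_distrib sum.distrib scaleR_left.sum
          del: index_mult_mat_vec)
    also have "\<dots> = q0 x + (\<Sum>j\<in>{1..N}. q j x)"
      by (subst sum.swap) (simp add: q_def lin_comb_def)
    finally show ?thesis .
  qed
  \<comment> \<open>For the lower bound the coarse space joins the local spaces as number \<open>0\<close>.\<close>
  define Q where "Q x j = (if j = 0 then q0 x else q j x)" for x and j :: nat
  define U where "U j = (if j = 0 then W0 else W j)" for j :: nat
  have U: "U j \<subseteq> V" if "j \<in> {0..N}" for j using that coarse loc by (auto simp: U_def)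
  have Q: "Q x j \<in> U j" "\<And>z. z \<in> U j \<Longrightarrow> a (Q x j) z = a (?c x) z"
    if "x \<in> carrier_vec n" "j \<in> {0..N}" for x j
    using that q0 q[OF that(1), of j] by (auto simp: Q_def U_def)
  have split0: "(\<Sum>j\<in>{0..N}. f j) = f 0 + (\<Sum>j\<in>{1..N}. f j)" for f :: "nat \<Rightarrow> 'z::comm_monoid_add"
    by (simp add: sum.atLeast_Suc_atMost)
  have c_MA': "?c ((M * A) *\<^sub>v x) = (\<Sum>j\<in>{0..N}. Q x j)" if "x \<in> carrier_vec n" for x
    unfolding split0 c_MA[OF that] by (simp add: Q_def)
  have Q_self: "a (Q x j) (?c x) = a (Q x j) (Q x j)" if "x \<in> carrier_vec n" "j \<in> {0..N}" for x j
    using Q(2)[OF that Q(1)[OF that]] commute[OF _ cV, of "Q x j" x] Q(1)[OF that] U[OF that(2)] by auto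
  have QV: "Q x j \<in> V" if "x \<in> carrier_vec n" "j \<in> {0..N}" for x j
    using Q(1)[OF that] U[OF that(2)] by auto
  have adj: "a (?c ((M * A) *\<^sub>v x)) (?c y) = a (?c x) (?c ((M * A) *\<^sub>v y))"
    if x: "x \<in> carrier_vec n" and y: "y \<in> carrier_vec n" for x y
  proof -
    have "a (?c ((M * A) *\<^sub>v x)) (?c y) = (\<Sum>j\<in>{0..N}. a (Q x j) (?c y))"
      unfolding c_MA'[OF x] using QV[OF x] cV by (intro sum_left) auto
    also have "\<dots> = (\<Sum>j\<in>{0..N}. a (?c x) (Q y j))"
    proof (intro sum.cong refl)
      fix j assume j: "j \<in> {0..N}"
      have "a (Q x j) (?c y) = a (?c y) (Q x j)" using QV[OF x j] cV commute by blast
      also have "\<dots> = a (Q y j) (Q x j)" using Q(2)[OF y j Q(1)[OF x j]] by simp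
      also have "\<dots> = a (Q x j) (Q y j)" using QV[OF x j] QV[OF y j] commute by blast
      also have "\<dots> = a (?c x) (Q y j)" using Q(2)[OF x j Q(1)[OF y j]] .
      finally show "a (Q x j) (?c y) = a (?c x) (Q y j)" .
    qed
    also have "\<dots> = a (?c x) (?c ((M * A) *\<^sub>v y))"
      unfolding c_MA'[OF y] using QV[OF y] cV by (intro sum_right[symmetric]) auto
    finally show ?thesis .
  qed
  have bounds: "0 < C \<and> 1 / C \<le> e \<and> e \<le> 1 + k" if e: "eigenvalue (M * A) e" for e
  proof -
    obtain x where x: "x \<in> carrier_vec n" "x \<noteq> 0\<^sub>v n" "(M * A) *\<^sub>v x = e \<cdot>\<^sub>v x"
      using e M by (auto simp: eigenvalue_def eigenvector_def)
    define v where "v = ?c x"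
    have v: "v \<in> V" using cV by (simp add: v_def)
    have "a v v \<noteq> 0"
      using definite[OF v] lin_comb_eq_0[OF \<phi> x(1)] x(2) by (auto simp: v_def)
    then have pos: "0 < a v v" using nonneg[OF v] by simp
    have ev: "(\<Sum>j\<in>{0..N}. Q x j) = e *\<^sub>R v"
      using c_MA'[OF x(1)] x by (simp add: v_def lin_comb_smult)
    have q0V: "q0 x \<in> V" using q0(1)[OF x(1)] coarse by auto
    have qV: "q j x \<in> V" if "j \<in> {1..N}" for j
      using q(1)[OF x(1) that] loc(2)[OF that] by auto
    have "a (q0 x) v \<le> 1 * a v v"
      using subspace_correction_bound_above[of "{0}" v "\<lambda>_. q0 x" 1] v q0V Q_self[OF x(1), of 0]
      by (simp add: Q_def v_def)
    moreover have "a (\<Sum>j\<in>{1..N}. q j x) v \<le> k * a v v"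
    proof (rule subspace_correction_bound_above)
      show "a (q j x) v = a (q j x) (q j x)" if "j \<in> {1..N}" for j
        using Q_self[OF x(1), of j] that by (simp add: Q_def v_def)
      show "a (\<Sum>j\<in>{1..N}. q j x) (\<Sum>j\<in>{1..N}. q j x) \<le> k * (\<Sum>j\<in>{1..N}. a (q j x) (q j x))"
        using q(1)[OF x(1)] by (rule strengthened)
    qed (use v qV k in auto)
    moreover have "e * a v v = a (q0 x) v + a (\<Sum>j\<in>{1..N}. q j x) v"
      using v q0V qV c_MA[OF x(1)] x mem(5)[of "{1..N}" "\<lambda>j. q j x"]
      by (simp add: v_def lin_comb_smult flip: scale_left add_left)
    ultimately have "e * a v v \<le> (1 + k) * a v v" by (simp add: algebra_simps)
    then have upper: "e \<le> 1 + k" using pos by simp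
    obtain w0 w where w0: "w0 \<in> W0" and w: "\<And>j. j \<in> {1..N} \<Longrightarrow> w j \<in> W j"
      and sum: "v = w0 + (\<Sum>j\<in>{1..N}. w j)"
      and st: "a w0 w0 + (\<Sum>j\<in>{1..N}. a (w j) (w j)) \<le> C * a v v"
      using stable[OF v] by blast
    define w' where "w' j = (if j = 0 then w0 else w j)" for j :: nat
    have w'U: "w' j \<in> U j" if "j \<in> {0..N}" for j using that w0 w by (auto simp: w'_def U_def)
    have "a v v \<le> C * a (\<Sum>j\<in>{0..N}. Q x j) v"
    proof (rule subspace_correction_bound_below)
      show "v = (\<Sum>j\<in>{0..N}. w' j)" unfolding split0 sum by (simp add: w'_def)
      show "(\<Sum>j\<in>{0..N}. a (w' j) (w' j)) \<le> C * a v v" unfolding split0 using st by (simp add: w'_def)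
      show "a (Q x j) v = a (Q x j) (Q x j)" if "j \<in> {0..N}" for j
        using Q_self[OF x(1) that] by (simp add: v_def)
      show "a (Q x j) (w' j) = a v (w' j)" if "j \<in> {0..N}" for j
        using Q(2)[OF x(1) that w'U[OF that]] by (simp add: v_def)
      show "w' j \<in> V" if "j \<in> {0..N}" for j using w'U[OF that] U[OF that] by auto
    qed (use v pos QV[OF x(1)] in auto)
    then have "a v v \<le> (C * e) * a v v" unfolding ev using v by (simp add: scale_left)
    then have Ce: "1 \<le> C * e" using pos by simp
    have "w j \<in> V" if "j \<in> {1..N}" for j using w[OF that] loc(2)[OF that] by auto
    then have "0 \<le> a w0 w0 + (\<Sum>j\<in>{1..N}. a (w j) (w j))"
      using w0 coarse by (intro add_nonneg_nonneg sum_nonneg nonneg) blast+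
    then have "0 \<le> C * a v v" using st by linarith
    then have "0 \<le> C" using pos by (simp add: zero_le_mult_iff)
    moreover have "C \<noteq> 0" using Ce by auto
    ultimately have "0 < C" by simp
    then show ?thesis using Ce upper by (simp add: field_simps)
  qed
  define X where "X = {e. eigenvalue (M * A) e}"
  have "finite X"
  proof -
    have "char_poly (M * A) \<noteq> 0" using degree_monic_char_poly[OF MA] by auto
    then show ?thesis
      unfolding X_def eigenvalue_root_char_poly[OF MA] by (rule poly_roots_finite)
  qed
  moreover have "X \<noteq> {}"
    unfolding X_def using self_adjoint_real_eigenvalue[OF definite \<phi> n MA adj] by auto
  ultimately have XM: "Max X \<in> X" "Min X \<in> X" by auto
  then have C: "0 < C" and Min: "1 / C \<le> Min X" and Max: "Max X \<le> 1 + k" using bounds by (auto simp: X_def)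
  have "Max X / Min X \<le> (1 + k) / (1 / C)"
    using C Min Max k by (intro frac_le) auto
  then show ?thesis by (simp add: cond_number_def X_def)
qed

end

section \<open>Energies of finite element functions\<close>

lemma restr_add: "restr X (u + v) = restr X u + restr X v"
  by (auto simp: restr_def)

lemma restr_scale: "restr X (c *\<^sub>R v) = c *\<^sub>R restr X v"
  by (auto simp: restr_def scaleR_fun_def)

lemma restr_restr: "X \<subseteq> Y \<Longrightarrow> restr X (restr Y v) = restr X v"
  by (auto simp: restr_def fun_eq_iff)

lemma restr_apply: "x \<in> X \<Longrightarrow> restr X v x = v x"
  by (simp add: restr_def)

lemma grad_cong:
  assumes "open U" "x \<in> U" "\<And>y. y \<in> U \<Longrightarrow> u y = v y"
  shows "grad u x = grad v x"
proof -
  have "(u has_derivative f) (at x) = (v has_derivative f) (at x)" for f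
    using assms has_derivative_transform_within_open[of u f x UNIV U v]
      has_derivative_transform_within_open[of v f x UNIV U u] by auto
  then have "frechet_derivative u (at x) = frechet_derivative v (at x)"
    by (simp add: frechet_derivative_def)
  then show ?thesis by (simp add: grad_def)
qed

lemma grad_add:
  assumes "u differentiable at x" "v differentiable at x"
  shows "grad (u + v) x = grad u x + grad v x"
proof -
  have "((\<lambda>y. u y + v y) has_derivative (\<lambda>h. frechet_derivative u (at x) h + frechet_derivative v (at x) h)) (at x)"
    using assms by (intro has_derivative_add) (auto simp: frechet_derivative_works[symmetric])
  from frechet_derivative_at[OF this, symmetric] show ?thesis
    by (simp add: grad_def plus_fun_def Finite_Cartesian_Product.vec_eq_iff)
qed

lemma grad_scale:
  assumes "u differentiable at x"
  shows "grad (c *\<^sub>R u) x = c *\<^sub>R grad u x"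
proof -
  have "((\<lambda>y. c *\<^sub>R u y) has_derivative (\<lambda>h. c *\<^sub>R frechet_derivative u (at x) h)) (at x)"
    using assms by (intro has_derivative_scaleR_right) (auto simp: frechet_derivative_works[symmetric])
  from frechet_derivative_at[OF this, symmetric] show ?thesis
    by (simp add: grad_def scaleR_fun_def Finite_Cartesian_Product.vec_eq_iff)
qed

text \<open>
  The restriction of a function to an element need not be differentiable on the boundary of the
  element, where its gradient is an arbitrary value.  The boundary is a null set, so energies of
  restrictions are energies of the functions that are restricted.
\<close>

lemma dform_cong_interior:
  assumes neg: "negligible (frontier \<tau>)" "closed \<tau>"
    and int: "set_integrable lebesgue \<tau> (\<lambda>x. inner (\<alpha> x *v grad u x) (grad v x))"
    and eq: "\<And>x. x \<in> interior \<tau> \<Longrightarrow> u x = u' x" "\<And>x. x \<in> interior \<tau> \<Longrightarrow> v x = v' x"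
  shows "dform \<alpha> \<tau> u v = dform \<alpha> \<tau> u' v'"
proof -
  let ?f = "\<lambda>x. inner (\<alpha> x *v grad u x) (grad v x)" and ?g = "\<lambda>x. inner (\<alpha> x *v grad u' x) (grad v' x)"
  have fg: "?g x = ?f x" if "x \<in> \<tau> - frontier \<tau>" for x
  proof -
    have "x \<in> interior \<tau>" using that neg(2) by (auto simp: frontier_def)
    then have "grad u x = grad u' x" "grad v x = grad v' x"
      using eq by (auto intro!: grad_cong[where U = "interior \<tau>"])
    then show ?thesis by simp
  qed
  have int': "set_integrable lebesgue \<tau> ?g"
    by (rule absolutely_integrable_spike[OF int neg(1) fg])
  show "dform \<alpha> \<tau> u v = dform \<alpha> \<tau> u' v'"
    unfolding dform_def set_lebesgue_integral_eq_integral(2)[OF int]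
      set_lebesgue_integral_eq_integral(2)[OF int']
    by (rule integral_spike[OF neg(1)]) (use fg in auto)
qed

locale fe_setting =
  fixes \<Omega> \<Gamma>D :: "(real ^ 'd) set" and T :: "(real ^ 'd) set set"
    and P :: "(real ^ 'd) set \<Rightarrow> (real ^ 'd \<Rightarrow> real) set" and V :: "(real ^ 'd \<Rightarrow> real) set"
    and \<alpha> :: "real ^ 'd \<Rightarrow> real ^ 'd ^ 'd"
  assumes open_domain: "open \<Omega>" and null_boundary: "negligible (frontier \<Omega>)"
    and mesh: "is_mesh \<Omega> T"
    and shape: "\<And>\<tau>. \<tau> \<in> T \<Longrightarrow> shape_space \<tau> (P \<tau>)"
    and V_eq: "V = fe_space T P \<Gamma>D"
    and conforming: "\<And>v. v \<in> V \<Longrightarrow> in_H1 \<Omega> v"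
    and well_defined: "\<And>u v. \<lbrakk>u \<in> V; v \<in> V\<rbrakk> \<Longrightarrow>
      set_integrable lebesgue \<Omega> (\<lambda>x. inner (\<alpha> x *v grad u x) (grad v x))"
    and coercive: "coercive_on V (H1_norm \<Omega>) (dform \<alpha> \<Omega>)"
    and psd_elements: "\<And>\<tau>. \<tau> \<in> T \<Longrightarrow> psd_on V (dform \<alpha> \<tau>)"
begin

lemma finite_mesh: "finite T" and mesh_cover: "\<Union>T = closure \<Omega>"
  using mesh by (auto simp: is_mesh_def)

lemma element:
  assumes "\<tau> \<in> T"
  shows "closed \<tau>" "closure (interior \<tau>) = \<tau>" "negligible (frontier \<tau>)"
  using mesh assms by (auto simp: is_mesh_def compact_imp_closed)

lemma closed_Union: "D \<subseteq> T \<Longrightarrow> closed (\<Union>D)"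
  using finite_mesh element(1) by (intro closed_Union) (auto intro: finite_subset)

lemma interior_disjoint_Union:
  assumes "D \<subseteq> T" "\<tau> \<in> T" "\<tau> \<notin> D"
  shows "interior \<tau> \<inter> \<Union>D = {}"
proof -
  have "interior \<tau> \<inter> \<sigma> = {}" if "\<sigma> \<in> D" for \<sigma>
  proof -
    have "\<sigma> \<in> T" "\<tau> \<noteq> \<sigma>" using assms that by auto
    then have "interior \<tau> \<inter> interior \<sigma> = {}"
      using mesh assms(2) by (simp add: is_mesh_def)
    then have "interior \<tau> \<inter> closure (interior \<sigma>) = {}"
      by (simp add: open_Int_closure_eq_empty)
    then show ?thesis using element(2) that assms by auto
  qed
  then show ?thesis by auto
qed

text \<open>
  An element is the closure of its interior, so each of its points is a limit of points outside the
  union of any family that does not contain it, and cannot be interior to that union.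
\<close>

lemma interface_eq:
  assumes "D \<subseteq> T" "D' \<subseteq> T" "D \<inter> D' = {}"
  shows "interface D D' = \<Union>D \<inter> \<Union>D'"
proof -
  have "x \<in> frontier (\<Union>F)" if F: "F \<subseteq> T" "G \<subseteq> T" "F \<inter> G = {}" and x: "x \<in> \<Union>F" "x \<in> \<Union>G" for F G x
  proof -
    obtain \<tau> where \<tau>: "\<tau> \<in> G" "x \<in> \<tau>" using x by auto
    have "interior \<tau> \<inter> \<Union>F = {}" using F \<tau> by (intro interior_disjoint_Union) auto
    then have "interior \<tau> \<inter> interior (\<Union>F) = {}" using interior_subset by blast
    then have "closure (interior \<tau>) \<inter> interior (\<Union>F) = {}"
      using open_Int_closure_eq_empty[OF open_interior, of "\<Union>F" "interior \<tau>"] by auto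
    then have "x \<notin> interior (\<Union>F)" using element(2)[of \<tau>] \<tau> F by auto
    then show ?thesis using x closure_subset[of "\<Union>F"] by (auto simp: frontier_def)
  qed
  from this[of D D'] this[of D' D] show ?thesis
    using assms closed_Union frontier_subset_closed unfolding interface_def by blast
qed

lemma eq_on_closure:
  fixes f g :: "real ^ 'd \<Rightarrow> real"
  assumes \<tau>: "\<tau> \<in> T" and "continuous_on \<tau> f" "continuous_on \<tau> g"
    and eq: "\<And>y. y \<in> interior \<tau> \<Longrightarrow> f y = g y" and x: "x \<in> \<tau>"
  shows "f x = g x"
proof -
  have "continuous_on (closure (interior \<tau>)) (\<lambda>y. f y - g y)"
    using assms element(2)[OF \<tau>] by (auto intro: continuous_on_diff)
  then have "f x - g x = 0"
    by (rule continuous_constant_on_closure) (use eq x element(2)[OF \<tau>] in auto)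
  then show ?thesis by simp
qed

lemma V_continuous: "v \<in> V \<Longrightarrow> D \<subseteq> T \<Longrightarrow> continuous_on (\<Union>D) v"
  by (auto simp: V_eq fe_space_def intro: continuous_on_subset)

lemma V_continuous_element: "v \<in> V \<Longrightarrow> \<tau> \<in> T \<Longrightarrow> continuous_on \<tau> v"
  using V_continuous[of v "{\<tau>}"] by simp

lemma V_outside: "v \<in> V \<Longrightarrow> x \<notin> \<Union>T \<Longrightarrow> v x = 0"
  by (auto simp: V_eq fe_space_def)

lemma shape_subspace: "\<tau> \<in> T \<Longrightarrow> subspace (P \<tau>)"
  using shape[of \<tau>] by (auto simp: shape_space_def)

lemma V_subspace: "subspace V"
proof (rule subspaceI)
  show "0 \<in> V"
    using shape_subspace by (auto simp: V_eq fe_space_def zero_fun_def intro!: bexI[of _ 0] subspace_0)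
next
  fix u v assume "u \<in> V" "v \<in> V"
  then show "u + v \<in> V"
    unfolding V_eq fe_space_def plus_fun_def mem_Collect_eq
  proof (intro conjI ballI; elim conjE)
    fix \<tau> assume \<tau>: "\<tau> \<in> T" and "\<forall>\<tau>\<in>T. \<exists>p\<in>P \<tau>. \<forall>x\<in>\<tau>. u x = p x" "\<forall>\<tau>\<in>T. \<exists>p\<in>P \<tau>. \<forall>x\<in>\<tau>. v x = p x"
    then obtain p q where "p \<in> P \<tau>" "q \<in> P \<tau>" "\<forall>x\<in>\<tau>. u x = p x" "\<forall>x\<in>\<tau>. v x = q x" by blast
    then show "\<exists>p\<in>P \<tau>. \<forall>x\<in>\<tau>. u x + v x = p x"
      using subspace_add[OF shape_subspace[OF \<tau>]] by (intro bexI[of _ "p + q"]) auto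
  qed (auto intro: continuous_on_add)
next
  fix c v assume "v \<in> V"
  then show "c *\<^sub>R v \<in> V"
    unfolding V_eq fe_space_def scaleR_fun_def mem_Collect_eq
  proof (intro conjI ballI; elim conjE)
    fix \<tau> assume \<tau>: "\<tau> \<in> T" and "\<forall>\<tau>\<in>T. \<exists>p\<in>P \<tau>. \<forall>x\<in>\<tau>. v x = p x"
    then obtain p where "p \<in> P \<tau>" "\<forall>x\<in>\<tau>. v x = p x" by blast
    then show "\<exists>p\<in>P \<tau>. \<forall>x\<in>\<tau>. c *\<^sub>R v x = p x"
      using subspace_scale[OF shape_subspace[OF \<tau>]]
      by (intro bexI[of _ "c *\<^sub>R p"]) (auto simp: scaleR_fun_def)
  qed (auto intro: continuous_on_mult continuous_on_const)
qed

lemmas V_mem = subspace_add[OF V_subspace] subspace_scale[OF V_subspace]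
  subspace_diff[OF V_subspace] subspace_sum[OF V_subspace]

lemma V_differentiable:
  assumes "v \<in> V" "\<tau> \<in> T" "x \<in> interior \<tau>"
  shows "v differentiable at x"
proof -
  obtain p where p: "p \<in> P \<tau>" "\<forall>x\<in>\<tau>. v x = p x" using assms by (auto simp: V_eq fe_space_def)
  then have "p differentiable_on interior \<tau>" using shape[OF assms(2)] by (simp add: shape_space_def)
  then have "p differentiable at x"
    using assms(3) at_within_open[OF assms(3) open_interior] unfolding differentiable_on_def by metis
  then obtain f where "(p has_derivative f) (at x)" by (auto simp: differentiable_def)
  then have "(v has_derivative f) (at x)"
    using p(2) assms(3) interior_subset[of \<tau>]
    by (intro has_derivative_transform_within_open[of p f x UNIV "interior \<tau>" v]) auto
  then show ?thesis by (auto simp: differentiable_def)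
qed

lemma integrable_element:
  assumes "u \<in> V" "v \<in> V" "\<tau> \<in> T"
  shows "set_integrable lebesgue \<tau> (\<lambda>x. inner (\<alpha> x *v grad u x) (grad v x))"
proof -
  have sub: "\<tau> \<subseteq> closure \<Omega>" using mesh_cover assms by auto
  have meas: "\<tau> \<inter> \<Omega> \<in> sets lebesgue"
    using element(1)[OF assms(3)] open_domain by (intro sets.Int) auto
  have int: "set_integrable lebesgue (\<tau> \<inter> \<Omega>) (\<lambda>x. inner (\<alpha> x *v grad u x) (grad v x))"
    using well_defined[OF assms(1,2)] meas by (rule set_integrable_subset) auto
  have "\<tau> - \<tau> \<inter> \<Omega> \<subseteq> frontier \<Omega>"
    using sub open_domain by (auto simp: frontier_def interior_open)
  then have neg: "negligible (\<tau> - \<tau> \<inter> \<Omega>)" using null_boundary negligible_subset by blast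
  show ?thesis
    using int
  proof (subst absolutely_integrable_spike_set_eq[where T = "\<tau> \<inter> \<Omega>"])
    show "negligible {x \<in> \<tau> - \<tau> \<inter> \<Omega>. inner (\<alpha> x *v grad u x) (grad v x) \<noteq> 0}"
      by (rule negligible_subset[OF neg]) auto
    show "negligible {x \<in> \<tau> \<inter> \<Omega> - \<tau>. inner (\<alpha> x *v grad u x) (grad v x) \<noteq> 0}"
      by (rule negligible_subset[OF neg]) auto
  qed
qed

lemma dform_cong:
  assumes "u \<in> V" "v \<in> V" "\<tau> \<in> T"
    and "\<And>x. x \<in> interior \<tau> \<Longrightarrow> u x = u' x" "\<And>x. x \<in> interior \<tau> \<Longrightarrow> v x = v' x"
  shows "dform \<alpha> \<tau> u v = dform \<alpha> \<tau> u' v'"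
  by (rule dform_cong_interior[OF element(3,1)[OF assms(3)] integrable_element[OF assms(1-3)] assms(4,5)])

lemma semi_inner_element:
  assumes \<tau>: "\<tau> \<in> T"
  shows "semi_inner V (dform \<alpha> \<tau>)"
proof
  show "subspace V" by (rule V_subspace)
  show "psd_on V (dform \<alpha> \<tau>)" by (rule psd_elements[OF \<tau>])
  note eqI = set_lebesgue_integral_eq_integral(2)
  let ?f = "\<lambda>u v x. inner (\<alpha> x *v grad u x) (grad v x)"
  have off: "x \<in> interior \<tau>" if "x \<in> \<tau> - frontier \<tau>" for x
    using that closure_subset[of \<tau>] by (auto simp: frontier_def)
  fix u w assume u: "u \<in> V" and w: "w \<in> V"
  show "dform \<alpha> \<tau> (u + v) w = dform \<alpha> \<tau> u w + dform \<alpha> \<tau> v w" if v: "v \<in> V" for v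
  proof -
    have "dform \<alpha> \<tau> (u + v) w = integral \<tau> (?f (u + v) w)"
      unfolding dform_def using u v w \<tau> by (intro eqI integrable_element V_mem)
    also have "\<dots> = integral \<tau> (\<lambda>x. ?f u w x + ?f v w x)"
      by (rule integral_spike[OF element(3)[OF \<tau>]])
        (use off V_differentiable[OF _ \<tau>] u v in \<open>auto simp: grad_add matrix_vector_right_distrib inner_add_left\<close>)
    also have "\<dots> = set_lebesgue_integral lebesgue \<tau> (\<lambda>x. ?f u w x + ?f v w x)"
      using integrable_element[OF u w \<tau>] integrable_element[OF v w \<tau>]
      by (intro eqI[symmetric] set_integral_add)
    also have "\<dots> = dform \<alpha> \<tau> u w + dform \<alpha> \<tau> v w"
      unfolding dform_def using integrable_element[OF u w \<tau>] integrable_element[OF v w \<tau>]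
      by (rule set_integral_add)
    finally show ?thesis .
  qed
  show "dform \<alpha> \<tau> (c *\<^sub>R u) w = c * dform \<alpha> \<tau> u w" for c
  proof -
    have "dform \<alpha> \<tau> (c *\<^sub>R u) w = integral \<tau> (?f (c *\<^sub>R u) w)"
      unfolding dform_def using u w \<tau> by (intro eqI integrable_element V_mem)
    also have "\<dots> = integral \<tau> (\<lambda>x. c * ?f u w x)"
      by (rule integral_spike[OF element(3)[OF \<tau>]])
        (use off V_differentiable[OF u \<tau>] in \<open>auto simp: grad_scale matrix_vector_mult_scaleR\<close>)
    also have "\<dots> = c * integral \<tau> (?f u w)" by simp
    also have "\<dots> = c * dform \<alpha> \<tau> u w"
      unfolding dform_def using eqI[OF integrable_element[OF u w \<tau>]] by simp
    finally show ?thesis .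
  qed
qed

lemma semi_inner_a_on:
  assumes D: "D \<subseteq> T"
  shows "semi_inner V (a_on \<alpha> D)"
proof
  show "psd_on V (a_on \<alpha> D)"
    using psd_elements D by (auto simp: psd_on_def symmetric_on_def a_on_def subset_eq intro!: sum.cong sum_nonneg)
  note s = semi_inner.add_left[OF semi_inner_element] semi_inner.scale_left[OF semi_inner_element]
  fix u w assume uw: "u \<in> V" "w \<in> V"
  show "a_on \<alpha> D (u + v) w = a_on \<alpha> D u w + a_on \<alpha> D v w" if "v \<in> V" for v
    unfolding a_on_def sum.distrib[symmetric] using uw that D by (intro sum.cong refl s) auto
  show "a_on \<alpha> D (c *\<^sub>R u) w = c * a_on \<alpha> D u w" for c
    unfolding a_on_def sum_distrib_left using uw D by (intro sum.cong refl s) auto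
qed (rule V_subspace)

lemma a_on_cong:
  assumes "u \<in> V" "v \<in> V" "D \<subseteq> T"
    and "\<And>x. x \<in> \<Union>D \<Longrightarrow> u x = u' x" "\<And>x. x \<in> \<Union>D \<Longrightarrow> v x = v' x"
  shows "a_on \<alpha> D u v = a_on \<alpha> D u' v'"
  unfolding a_on_def using assms interior_subset by (intro sum.cong refl dform_cong) blast+

lemma a_on_restr:
  assumes "u \<in> V" "v \<in> V" "D \<subseteq> T"
  shows "a_on \<alpha> D (restr (\<Union>D) u) (restr (\<Union>D) v) = a_on \<alpha> D u v"
  by (rule a_on_cong[OF assms, symmetric]) (simp_all add: restr_apply)

lemma a_on_mono:
  assumes "D \<subseteq> D'" "D' \<subseteq> T" "v \<in> V"
  shows "a_on \<alpha> D v v \<le> a_on \<alpha> D' v v"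
  unfolding a_on_def using assms finite_mesh semi_inner.nonneg[OF semi_inner_element, of _ v]
  by (intro sum_mono2) (auto intro: finite_subset)

lemma a_on_disjoint_Un:
  assumes "D \<union> D' \<subseteq> T" "D \<inter> D' = {}"
  shows "a_on \<alpha> (D \<union> D') u v = a_on \<alpha> D u v + a_on \<alpha> D' u v"
  unfolding a_on_def using assms finite_mesh by (intro sum.union_disjoint) (auto intro: finite_subset)

lemma Vh_on_subspace: "subspace (Vh_on V D)"
  unfolding Vh_on_def
proof (rule subspaceI)
  show "0 \<in> restr (\<Union>D) ` V"
    using subspace_0[OF V_subspace] by (intro image_eqI[of _ _ 0]) (auto simp: restr_def)
qed (auto simp: V_mem simp flip: restr_add restr_scale)

lemma semi_inner_Vh_on:
  assumes D: "D \<subseteq> T"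
  shows "semi_inner (Vh_on V D) (a_on \<alpha> D)"
proof -
  interpret s: semi_inner V "a_on \<alpha> D" by (rule semi_inner_a_on[OF D])
  have r: "a_on \<alpha> D (restr (\<Union>D) u) (restr (\<Union>D) v) = a_on \<alpha> D u v" if "u \<in> V" "v \<in> V" for u v
    using that D by (rule a_on_restr)
  show ?thesis
  proof
    show "psd_on (Vh_on V D) (a_on \<alpha> D)"
      by (auto simp: psd_on_def symmetric_on_def Vh_on_def r s.nonneg s.commute)
  next
    fix u v w assume "u \<in> Vh_on V D" "v \<in> Vh_on V D" "w \<in> Vh_on V D"
    then show "a_on \<alpha> D (u + v) w = a_on \<alpha> D u w + a_on \<alpha> D v w"
      by (auto simp: Vh_on_def r s.add_left V_mem simp flip: restr_add)
  next
    fix u w and c :: real assume "u \<in> Vh_on V D" "w \<in> Vh_on V D"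
    then show "a_on \<alpha> D (c *\<^sub>R u) w = c * a_on \<alpha> D u w"
      by (auto simp: Vh_on_def r s.scale_left V_mem simp flip: restr_scale)
  qed (rule Vh_on_subspace)
qed

lemma Vh0_on_eq:
  assumes "D \<subseteq> T"
  shows "Vh0_on V D = {v \<in> V. \<forall>x. x \<notin> \<Union>D \<longrightarrow> v x = 0}"
proof (rule subset_antisym; rule subsetI)
  fix v assume "v \<in> Vh0_on V D"
  then obtain u where u: "u \<in> V" "supp u \<subseteq> \<Union>D" "v = restr (\<Union>D) u" by (auto simp: Vh0_on_def)
  have "u x = 0" if "x \<notin> \<Union>D" for x
    using that u(2) closure_subset[of "{x. u x \<noteq> 0}"] by (auto simp: supp_def)
  moreover from this have "v = u" using u(3) by (auto simp: restr_def)
  ultimately show "v \<in> {v \<in> V. \<forall>x. x \<notin> \<Union>D \<longrightarrow> v x = 0}" using u by auto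
next
  fix v assume v: "v \<in> {v \<in> V. \<forall>x. x \<notin> \<Union>D \<longrightarrow> v x = 0}"
  then have "supp v \<subseteq> \<Union>D" unfolding supp_def using closed_Union[OF assms] by (intro closure_minimal) auto
  moreover have "v = restr (\<Union>D) v" using v by (auto simp: restr_def)
  ultimately show "v \<in> Vh0_on V D" using v unfolding Vh0_on_def by blast
qed

lemma Vh0_on_subspace:
  assumes "D \<subseteq> T" shows "subspace (Vh0_on V D)"
  unfolding Vh0_on_eq[OF assms] using V_subspace
  by (auto intro!: subspaceI simp: subspace_def scaleR_fun_def)

lemma Vh0_on_subset: "D \<subseteq> T \<Longrightarrow> Vh0_on V D \<subseteq> V"
  by (auto simp: Vh0_on_eq)

lemma Vh0_on_subset_Vh_on: "Vh0_on V D \<subseteq> Vh_on V D"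
  by (auto simp: Vh0_on_def Vh_on_def)

text \<open>
  The content is at the points of \<open>\<tau>\<close> that lie on \<open>\<Union>D\<close>: they are limits of interior points of
  \<open>\<tau>\<close>, which lie outside \<open>\<Union>D\<close>.
\<close>

lemma Vh0_on_vanishes:
  assumes D: "D \<subseteq> T" and v: "v \<in> Vh0_on V D" and \<tau>: "\<tau> \<in> T" "\<tau> \<notin> D" and x: "x \<in> \<tau>"
  shows "v x = 0"
proof (rule eq_on_closure[OF \<tau>(1), of v "\<lambda>_. 0"])
  show "continuous_on \<tau> v" using v D \<tau> by (auto simp: Vh0_on_eq intro: V_continuous_element)
  show "v y = 0" if "y \<in> interior \<tau>" for y
    using that v interior_disjoint_Union[OF D \<tau>] unfolding Vh0_on_eq[OF D] by blast
qed (use x in auto)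

text \<open>The glued function stays continuous because the two closed pieces meet only where \<open>w\<close> is zero.\<close>

lemma extension_by_zero:
  assumes D: "D \<subseteq> T" and w: "w \<in> V"
    and zero: "\<And>\<tau> \<sigma> x. \<lbrakk>\<tau> \<in> D; \<sigma> \<in> T - D; x \<in> \<tau>; x \<in> \<sigma>\<rbrakk> \<Longrightarrow> w x = 0"
  shows "restr (\<Union>D) w \<in> Vh0_on V D"
proof -
  let ?w = "restr (\<Union>D) w"
  have out: "?w x = 0" if "x \<in> \<Union>(T - D)" for x
    using that zero by (auto simp: restr_def)
  have "continuous_on (\<Union>D) ?w"
    using V_continuous[OF w D] by (rule continuous_on_cong[THEN iffD1, rotated 2]) (auto simp: restr_def)
  moreover have "continuous_on (\<Union>(T - D)) ?w"
    by (rule continuous_on_cong[THEN iffD1, OF refl _ continuous_on_const[of _ 0]]) (use out in auto)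
  ultimately have "continuous_on (\<Union>D \<union> \<Union>(T - D)) ?w"
    using closed_Union[OF D] closed_Union[of "T - D"] by (intro continuous_on_closed_Un) auto
  moreover have "\<Union>D \<union> \<Union>(T - D) = \<Union>T" using D by auto
  ultimately have cont: "continuous_on (\<Union>T) ?w" by simp
  have "\<exists>p\<in>P \<tau>. \<forall>x\<in>\<tau>. ?w x = p x" if \<tau>: "\<tau> \<in> T" for \<tau>
  proof (cases "\<tau> \<in> D")
    case True
    obtain p where "p \<in> P \<tau>" "\<forall>x\<in>\<tau>. w x = p x" using w \<tau> by (auto simp: V_eq fe_space_def)
    then show ?thesis using True by (intro bexI[of _ p]) (auto simp: restr_def)
  next
    case False
    then show ?thesis
      using out \<tau> subspace_0[OF shape_subspace[OF \<tau>]] by (intro bexI[of _ 0]) auto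
  qed
  then have "?w \<in> V"
    using w cont D unfolding V_eq fe_space_def by (auto simp: restr_def)
  then show ?thesis using D by (auto simp: Vh0_on_eq restr_def)
qed

lemma a_on_support:
  assumes "D \<subseteq> T" "D' \<subseteq> T" "v \<in> Vh0_on V D"
  shows "a_on \<alpha> D' v v = a_on \<alpha> (D' \<inter> D) v v"
proof -
  have v: "v \<in> V" using assms Vh0_on_subset by auto
  have "dform \<alpha> \<tau> v v = 0" if "\<tau> \<in> D' - D" for \<tau>
  proof -
    have \<tau>: "\<tau> \<in> T" "\<tau> \<notin> D" using that assms by auto
    have "v x = 0" if "x \<in> interior \<tau>" for x
      using Vh0_on_vanishes[OF assms(1,3) \<tau>] that interior_subset by auto
    then have "dform \<alpha> \<tau> v v = dform \<alpha> \<tau> 0 v"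
      using v \<tau> by (intro dform_cong) auto
    then show ?thesis using semi_inner.zero_left[OF semi_inner_element[OF \<tau>(1)] v] by simp
  qed
  then show ?thesis
    unfolding a_on_def using assms finite_mesh
    by (intro sum.mono_neutral_right) (auto intro: finite_subset)
qed

text \<open>
  Distinct elements meet in null sets, and the elements cover the closure of the domain, which
  exceeds the domain by a null set.
\<close>

lemma dform_domain:
  assumes "u \<in> V" "v \<in> V"
  shows "dform \<alpha> \<Omega> u v = a_on \<alpha> T u v"
proof -
  let ?f = "\<lambda>x. inner (\<alpha> x *v grad u x) (grad v x)"
  have "(?f has_integral dform \<alpha> \<tau> u v) \<tau>" if "\<tau> \<in> T" for \<tau>
    unfolding dform_def using integrable_element[OF assms that] by (rule has_integral_set_lebesgue)
  moreover have "pairwise (\<lambda>S S'. negligible (S \<inter> S')) T"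
  proof (rule pairwiseI)
    fix \<tau> \<sigma> assume "\<tau> \<in> T" "\<sigma> \<in> T" "\<tau> \<noteq> \<sigma>"
    then have "\<tau> \<inter> \<sigma> \<subseteq> frontier \<tau>"
      using interior_disjoint_Union[of "{\<sigma>}" \<tau>] closure_subset[of \<tau>] by (auto simp: frontier_def)
    then show "negligible (\<tau> \<inter> \<sigma>)"
      using element(3)[OF \<open>\<tau> \<in> T\<close>] negligible_subset by blast
  qed
  ultimately have "(?f has_integral a_on \<alpha> T u v) (closure \<Omega>)"
    unfolding a_on_def mesh_cover[symmetric] using finite_mesh by (intro has_integral_Union) auto
  moreover have "negligible {x \<in> closure \<Omega> - \<Omega>. ?f x \<noteq> 0}"
    by (rule negligible_subset[OF null_boundary]) (use open_domain in \<open>auto simp: frontier_def interior_open\<close>)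
  moreover have "negligible {x \<in> \<Omega> - closure \<Omega>. ?f x \<noteq> 0}"
    by (rule negligible_subset[OF null_boundary]) (use closure_subset in auto)
  ultimately have "(?f has_integral a_on \<alpha> T u v) \<Omega>"
    using has_integral_spike_set_eq[of "closure \<Omega>" \<Omega> ?f "a_on \<alpha> T u v"] by blast
  moreover have "(?f has_integral dform \<alpha> \<Omega> u v) \<Omega>"
    unfolding dform_def using well_defined[OF assms] by (rule has_integral_set_lebesgue)
  ultimately show ?thesis by (rule has_integral_unique[symmetric])
qed

text \<open>
  Coercivity makes the \<open>L\<^sup>2\<close> norm vanish, and a continuous function that vanishes almost everywhere
  on an open set vanishes on the closure of this set.
\<close>

lemma definite:
  assumes v: "v \<in> V" and a: "a_on \<alpha> T v v = 0"
  shows "v = 0"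
proof -
  let ?g = "\<lambda>x. (norm (grad v x))\<^sup>2"
  obtain c where c: "0 < c" "c * (H1_norm \<Omega> v)\<^sup>2 \<le> 0"
    using coercive v a dform_domain[OF v v] by (force simp: coercive_on_def)
  have "(H1_norm \<Omega> v)\<^sup>2 \<le> 0" using c by (simp add: mult_le_0_iff)
  then have "H1_norm \<Omega> v = 0" by simp
  then have I0: "(LINT x:\<Omega>|lebesgue. (v x)\<^sup>2 + ?g x) = 0" by (simp add: H1_norm_def)
  have int: "set_integrable lebesgue \<Omega> (\<lambda>x. (v x)\<^sup>2)" "set_integrable lebesgue \<Omega> ?g"
    using conforming[OF v] by (auto simp: in_H1_def)
  have nonneg: "0 \<le> (LINT x:\<Omega>|lebesgue. (v x)\<^sup>2)" "0 \<le> (LINT x:\<Omega>|lebesgue. ?g x)"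
    unfolding set_lebesgue_integral_def by (rule integral_nonneg_AE; simp add: indicator_def)+
  then have "(LINT x:\<Omega>|lebesgue. (v x)\<^sup>2) = 0" using I0 set_integral_add(2)[OF int] by simp
  then have "AE x in lebesgue. indicator \<Omega> x *\<^sub>R (v x)\<^sup>2 = 0"
    using int(1) unfolding set_lebesgue_integral_def set_integrable_def
    by (subst (asm) integral_nonneg_eq_0_iff_AE) auto
  then obtain Z where "Z \<in> null_sets lebesgue" "{x. indicator \<Omega> x *\<^sub>R (v x)\<^sup>2 \<noteq> 0} \<subseteq> Z"
    by (auto simp: eventually_ae_filter)
  then have null: "negligible {x \<in> \<Omega>. v x \<noteq> 0}"
    unfolding negligible_iff_null_sets[symmetric] by (elim negligible_subset) (auto simp: indicator_def)
  have "continuous_on \<Omega> v"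
    using V_continuous[OF v order.refl] mesh_cover closure_subset by (metis continuous_on_subset)
  then have "open {x \<in> \<Omega>. v x \<noteq> 0}"
    using open_domain continuous_open_preimage[of \<Omega> v "- {0}"]
    by (simp add: open_Compl vimage_def Int_def)
  then have zero: "v x = 0" if "x \<in> \<Omega>" for x
    using null open_not_negligible that by blast
  have "v x = 0" if "x \<in> closure \<Omega>" for x
    by (rule continuous_constant_on_closure[of \<Omega>])
      (use V_continuous[OF v order.refl] mesh_cover that zero in auto)
  then show ?thesis using V_outside[OF v] mesh_cover by (auto simp: fun_eq_iff)
qed

end

section \<open>Stable decompositions\<close>

lemma sum_fun_apply: "(\<Sum>i\<in>I. f i) x = (\<Sum>i\<in>I. f i x)" for f :: "'i \<Rightarrow> 'a \<Rightarrow> 'b::comm_monoid_add"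
  by (induction I rule: infinite_finite_induct) simp_all

locale fe_decomposition = fe_setting \<Omega> \<Gamma>D T P V \<alpha>
  for \<Omega> \<Gamma>D :: "(real ^ 'd) set" and T P V \<alpha> +
  fixes N :: nat and S :: "nat \<Rightarrow> (real ^ 'd) set set"
    and \<xi> :: "nat \<Rightarrow> (real ^ 'd \<Rightarrow> real) \<Rightarrow> real ^ 'd \<Rightarrow> real"
  assumes S_sub: "\<And>j. j \<in> {1..N} \<Longrightarrow> S j \<subseteq> T" and pou: "partition_of_unity V N S \<xi>"
begin

abbreviation "Ov j \<equiv> overlap N S j"
abbreviation "In j \<equiv> inner_part N S j"
abbreviation "k0 \<equiv> real (max_multiplicity T N S)"

lemma parts:
  assumes "j \<in> {1..N}"
  shows "Ov j \<subseteq> T" "In j \<subseteq> T" "Ov j \<inter> In j = {}" "S j = Ov j \<union> In j"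
  using S_sub[OF assms] by (auto simp: overlap_def inner_part_def)

lemma card_le_k0:
  assumes "\<tau> \<in> T" shows "real (card {j \<in> {1..N}. \<tau> \<in> S j}) \<le> k0"
  unfolding max_multiplicity_def using assms finite_mesh by (intro of_nat_mono Max_ge) auto

lemma sum_subdomain_energies_le:
  assumes v: "v \<in> V"
  shows "(\<Sum>j\<in>{1..N}. a_on \<alpha> (S j) v v) \<le> k0 * a_on \<alpha> T v v"
proof -
  have "a_on \<alpha> (S j) v v = (\<Sum>\<tau>\<in>T. if \<tau> \<in> S j then dform \<alpha> \<tau> v v else 0)" if "j \<in> {1..N}" for j
    unfolding a_on_def sum.inter_restrict[OF finite_mesh, symmetric]
    using S_sub[OF that] by (simp add: Int_absorb1)
  then have "(\<Sum>j\<in>{1..N}. a_on \<alpha> (S j) v v) = (\<Sum>j\<in>{1..N}. \<Sum>\<tau>\<in>T. if \<tau> \<in> S j then dform \<alpha> \<tau> v v else 0)"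
    by (rule sum.cong[OF refl])
  also have "\<dots> = (\<Sum>\<tau>\<in>T. real (card {j \<in> {1..N}. \<tau> \<in> S j}) * dform \<alpha> \<tau> v v)"
  proof (subst sum.swap, rule sum.cong[OF refl])
    fix \<tau>
    have "{1..N} \<inter> {j. \<tau> \<in> S j} = {j \<in> {1..N}. \<tau> \<in> S j}" by auto
    then show "(\<Sum>j\<in>{1..N}. if \<tau> \<in> S j then dform \<alpha> \<tau> v v else 0)
        = real (card {j \<in> {1..N}. \<tau> \<in> S j}) * dform \<alpha> \<tau> v v"
      by (simp add: sum.If_cases)
  qed
  also have "\<dots> \<le> (\<Sum>\<tau>\<in>T. k0 * dform \<alpha> \<tau> v v)"
    using v by (intro sum_mono mult_right_mono card_le_k0 semi_inner.nonneg[OF semi_inner_element])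
  finally show ?thesis by (simp add: a_on_def sum_distrib_left)
qed

text \<open>On each element at most \<open>k\<^sub>0\<close> of the summands are nonzero.\<close>

lemma energy_sum_le:
  assumes q: "\<And>j. j \<in> {1..N} \<Longrightarrow> q j \<in> Vh0_on V (S j)"
  shows "a_on \<alpha> T (\<Sum>j\<in>{1..N}. q j) (\<Sum>j\<in>{1..N}. q j) \<le> k0 * (\<Sum>j\<in>{1..N}. a_on \<alpha> T (q j) (q j))"
proof -
  have qV: "q j \<in> V" if "j \<in> {1..N}" for j
    using q[OF that] Vh0_on_subset[OF S_sub[OF that]] by auto
  have "dform \<alpha> \<tau> (\<Sum>j\<in>{1..N}. q j) (\<Sum>j\<in>{1..N}. q j) \<le> k0 * (\<Sum>j\<in>{1..N}. dform \<alpha> \<tau> (q j) (q j))"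
    if \<tau>: "\<tau> \<in> T" for \<tau>
  proof -
    interpret s: semi_inner V "dform \<alpha> \<tau>" by (rule semi_inner_element[OF \<tau>])
    define J where "J = {j \<in> {1..N}. \<tau> \<in> S j}"
    have J: "finite J" "J \<subseteq> {1..N}" by (auto simp: J_def)
    have sum_eq: "(\<Sum>j\<in>{1..N}. q j) x = (\<Sum>j\<in>J. q j) x" if x: "x \<in> interior \<tau>" for x
    proof -
      have "q j x = 0" if j: "j \<in> {1..N} - J" for j
      proof (rule Vh0_on_vanishes[OF S_sub q \<tau>])
        show "x \<in> \<tau>" using x interior_subset by auto
      qed (use j in \<open>auto simp: J_def\<close>)
      then have "(\<Sum>j\<in>{1..N}. q j x) = (\<Sum>j\<in>J. q j x)"
        using J by (intro sum.mono_neutral_right) auto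
      then show ?thesis by (simp only: sum_fun_apply)
    qed
    have qs: "(\<Sum>j\<in>{1..N}. q j) \<in> V" using qV by (intro V_mem)
    have "dform \<alpha> \<tau> (\<Sum>j\<in>{1..N}. q j) (\<Sum>j\<in>{1..N}. q j) = dform \<alpha> \<tau> (\<Sum>j\<in>J. q j) (\<Sum>j\<in>J. q j)"
      by (rule dform_cong[OF qs qs \<tau> sum_eq sum_eq])
    also have "\<dots> \<le> real (card J) * (\<Sum>j\<in>J. dform \<alpha> \<tau> (q j) (q j))"
      using J qV by (intro s.norm_sum_le) auto
    also have "\<dots> \<le> k0 * (\<Sum>j\<in>{1..N}. dform \<alpha> \<tau> (q j) (q j))"
      unfolding J_def using \<tau> qV
      by (intro mult_mono card_le_k0 sum_mono2 sum_nonneg) (auto intro: s.nonneg)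
    finally show ?thesis .
  qed
  then have "a_on \<alpha> T (\<Sum>j\<in>{1..N}. q j) (\<Sum>j\<in>{1..N}. q j)
      \<le> (\<Sum>\<tau>\<in>T. k0 * (\<Sum>j\<in>{1..N}. dform \<alpha> \<tau> (q j) (q j)))"
    unfolding a_on_def by (rule sum_mono)
  also have "\<dots> = k0 * (\<Sum>j\<in>{1..N}. a_on \<alpha> T (q j) (q j))"
    unfolding a_on_def sum_distrib_left[symmetric] by (subst sum.swap) simp
  finally show ?thesis .
qed

context
  fixes j :: nat assumes j: "j \<in> {1..N}"
begin

lemma pou_linear: "lin_on (Vh_on V (S j)) (\<xi> j)"
  and pou_range: "v \<in> Vh_on V (S j) \<Longrightarrow> \<xi> j v \<in> Vh0_on V (S j)"
  and pou_identity: "v \<in> Vh_on V (S j) \<Longrightarrow> x \<in> \<Union>(S j) - \<Union>(Ov j) \<Longrightarrow> \<xi> j v x = v x"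
  and pou_local: "\<lbrakk>u \<in> Vh_on V (S j); v \<in> Vh_on V (S j);
      restr (\<Union>(Ov j)) u = restr (\<Union>(Ov j)) v\<rbrakk> \<Longrightarrow>
      restr (\<Union>(Ov j)) (\<xi> j u) = restr (\<Union>(Ov j)) (\<xi> j v)"
  using pou j unfolding partition_of_unity_def by blast+

lemma S_T: "S j \<subseteq> T"
  using S_sub[OF j] .

text \<open>
  On the interior of the elements outside the overlap this is an axiom of the partition of unity;
  by continuity it extends to their boundary.
\<close>

lemma pou_identity_closure:
  assumes v: "v \<in> V" and x: "x \<in> \<Union>(In j)"
  shows "\<xi> j (restr (\<Union>(S j)) v) x = v x"
proof -
  obtain \<tau> where \<tau>: "\<tau> \<in> In j" "x \<in> \<tau>" using x by auto
  have \<tau>T: "\<tau> \<in> T" "\<tau> \<notin> Ov j" "\<tau> \<in> S j" using parts[OF j] \<tau> by auto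
  have vS: "restr (\<Union>(S j)) v \<in> Vh_on V (S j)" using v by (simp add: Vh_on_def)
  have \<xi>V: "\<xi> j (restr (\<Union>(S j)) v) \<in> V" using pou_range[OF vS] Vh0_on_subset[OF S_T] by auto
  show ?thesis
  proof (rule eq_on_closure[OF \<tau>T(1) V_continuous_element[OF \<xi>V \<tau>T(1)]
        V_continuous_element[OF v \<tau>T(1)] _ \<tau>(2)])
    fix y assume y: "y \<in> interior \<tau>"
    then have "y \<in> \<Union>(S j) - \<Union>(Ov j)"
      using interior_disjoint_Union[OF parts(1)[OF j] \<tau>T(1,2)] \<tau>T(3) interior_subset by blast
    then show "\<xi> j (restr (\<Union>(S j)) v) y = v y"
      using pou_identity[OF vS] by (simp add: restr_def)
  qed
qed

text \<open>
  Where the part outside the overlap touches the complement of the subdomain, every function of the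
  finite element space vanishes: there \<open>\<xi>\<^sub>j\<close> is the identity, but its range vanishes.
\<close>

lemma vanishes_at_outer_boundary:
  assumes v: "v \<in> V" and x: "x \<in> \<Union>(In j)" "\<sigma> \<in> T" "\<sigma> \<notin> S j" "x \<in> \<sigma>"
  shows "v x = 0"
proof -
  have "\<xi> j (restr (\<Union>(S j)) v) \<in> Vh0_on V (S j)" using v by (intro pou_range) (simp add: Vh_on_def)
  then have "\<xi> j (restr (\<Union>(S j)) v) x = 0" using x S_T by (intro Vh0_on_vanishes)
  then show ?thesis using pou_identity_closure[OF v x(1)] by simp
qed

lemma interface_parts: "interface (Ov j) (In j) = \<Union>(Ov j) \<inter> \<Union>(In j)"
  using parts[OF j] by (intro interface_eq)

text \<open>
  The boundary of the part outside the overlap has two portions: the interface with the overlap,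
  where \<open>w\<close> is zero by assumption, and the boundary with elements outside the subdomain, where every
  function of the space is zero.
\<close>

lemma zero_trace_extension:
  assumes w: "w \<in> V" and zero: "\<And>x. x \<in> interface (Ov j) (In j) \<Longrightarrow> w x = 0"
  shows "restr (\<Union>(In j)) w \<in> Vh0_on V (In j)"
proof (rule extension_by_zero[OF parts(2)[OF j] w])
  fix \<tau> \<sigma> x assume *: "\<tau> \<in> In j" "\<sigma> \<in> T - In j" "x \<in> \<tau>" "x \<in> \<sigma>"
  show "w x = 0"
  proof (cases "\<sigma> \<in> S j")
    case True
    then have "\<sigma> \<in> Ov j" using * parts[OF j] by auto
    then show ?thesis using * by (intro zero) (auto simp: interface_parts)
  next
    case False
    then show ?thesis using * by (intro vanishes_at_outer_boundary[OF w, of x \<sigma>]) auto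
  qed
qed

lemma form_proj_inner:
  assumes W: "finite B" "V = span B" and v: "v \<in> Vh_on V (In j)"
  defines "q \<equiv> form_proj (a_on \<alpha> (In j)) (Vh0_on V (In j)) v"
  shows "q \<in> Vh0_on V (In j)"
    and "\<And>z. z \<in> Vh0_on V (In j) \<Longrightarrow> a_on \<alpha> (In j) q z = a_on \<alpha> (In j) v z"
proof -
  have I: "In j \<subseteq> T" using parts[OF j] by auto
  interpret s: semi_inner "Vh_on V (In j)" "a_on \<alpha> (In j)" by (rule semi_inner_Vh_on[OF I])
  have def: "z = 0" if "z \<in> Vh0_on V (In j)" "a_on \<alpha> (In j) z z = 0" for z
  proof (rule definite)
    show "z \<in> V" using that Vh0_on_subset[OF I] by auto
    show "a_on \<alpha> T z z = 0" using that(2) a_on_support[OF I order.refl that(1)] I by (simp add: Int_absorb1)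
  qed
  note fp = s.form_proj[OF Vh0_on_subspace[OF I] Vh0_on_subset_Vh_on W(1) _ def v]
  have "Vh0_on V (In j) \<subseteq> span B" using Vh0_on_subset[OF I] W(2) by simp
  then show "q \<in> Vh0_on V (In j)"
    and "\<And>z. z \<in> Vh0_on V (In j) \<Longrightarrow> a_on \<alpha> (In j) q z = a_on \<alpha> (In j) v z"
    unfolding q_def using fp by blast+
qed

text \<open>
  Both pieces are represented by global functions with equal values on the interface, so their
  difference extends by zero and the glued function is again a restriction of a global one.
\<close>

lemma glued_harmonic_extension:
  assumes W: "finite B" "V = span B"
    and E: "trace_extension V (interface (Ov j) (In j)) (In j) E"
    and D: "Ov j \<subseteq> D" and t: "t \<in> Vh_on V D"
  shows "\<exists>Y\<in>V. glued_harmonic \<alpha> V (Ov j) (In j) E t = restr (\<Union>(S j)) Y \<and>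
    (\<forall>x\<in>\<Union>(Ov j). Y x = t x) \<and> (\<forall>z\<in>Vh0_on V (In j). a_on \<alpha> (In j) Y z = 0)"
proof -
  let ?\<Gamma> = "interface (Ov j) (In j)"
  have I: "In j \<subseteq> T" and O: "Ov j \<subseteq> T" using parts[OF j] by auto
  obtain v where v: "v \<in> V" "t = restr (\<Union>D) v" using t by (auto simp: Vh_on_def)
  have tv: "t x = v x" if "x \<in> \<Union>(Ov j)" for x using that D v(2) by (auto simp: restr_def)
  have g: "restr ?\<Gamma> t = restr ?\<Gamma> v" using tv by (auto simp: restr_def interface_parts fun_eq_iff)
  then have Eg: "E (restr ?\<Gamma> t) \<in> Vh_on V (In j)" "restr ?\<Gamma> (E (restr ?\<Gamma> t)) = restr ?\<Gamma> t"
    using E v(1) unfolding trace_extension_def by auto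
  obtain u where u: "u \<in> V" "E (restr ?\<Gamma> t) = restr (\<Union>(In j)) u" using Eg(1) by (auto simp: Vh_on_def)
  define q where "q = form_proj (a_on \<alpha> (In j)) (Vh0_on V (In j)) (E (restr ?\<Gamma> t))"
  have q: "q \<in> Vh0_on V (In j)"
    and q_orth: "\<And>z. z \<in> Vh0_on V (In j) \<Longrightarrow> a_on \<alpha> (In j) q z = a_on \<alpha> (In j) (E (restr ?\<Gamma> t)) z"
    unfolding q_def using form_proj_inner[OF W Eg(1)] by auto
  have qV: "q \<in> V" using q Vh0_on_subset[OF I] by auto
  have uv: "u x = v x" if x: "x \<in> ?\<Gamma>" for x
  proof -
    have "restr ?\<Gamma> (restr (\<Union>(In j)) u) x = restr ?\<Gamma> v x" using Eg(2) u(2) g by simp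
    then show ?thesis using x by (simp add: restr_def interface_parts)
  qed
  have q0: "q x = 0" if x: "x \<in> ?\<Gamma>" for x
  proof -
    obtain \<sigma> where "\<sigma> \<in> Ov j" "x \<in> \<sigma>" using x by (auto simp: interface_parts)
    then show ?thesis using Vh0_on_vanishes[OF I q, of \<sigma> x] parts[OF j] by auto
  qed
  define w where "w = restr (\<Union>(In j)) (u - q - v)"
  have w: "w \<in> Vh0_on V (In j)"
    unfolding w_def using u v qV by (intro zero_trace_extension V_mem) (auto simp: uv q0)
  define Y where "Y = v + w"
  have YV: "Y \<in> V" unfolding Y_def using v w Vh0_on_subset[OF I] by (intro V_mem) auto
  have Y_O: "Y x = t x" if "x \<in> \<Union>(Ov j)" for x
  proof -
    have "w x = 0" using that by (simp add: w_def restr_def uv q0 interface_parts)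
    then show ?thesis using tv[OF that] by (simp add: Y_def)
  qed
  have Y_I: "Y x = u x - q x" if "x \<in> \<Union>(In j)" for x
    using that by (simp add: Y_def w_def restr_def)
  have "glued_harmonic \<alpha> V (Ov j) (In j) E t x = restr (\<Union>(S j)) Y x" for x
  proof -
    consider "x \<in> \<Union>(Ov j)" | "x \<notin> \<Union>(Ov j)" "x \<in> \<Union>(In j)" | "x \<notin> \<Union>(Ov j)" "x \<notin> \<Union>(In j)" by blast
    then show ?thesis
    proof cases
      case 1
      then show ?thesis using Y_O[OF 1] parts(4)[OF j] by (auto simp: glued_harmonic_def restr_def)
    next
      case 2
      then have "x \<in> \<Union>(S j)" using parts(4)[OF j] by auto
      then show ?thesis using 2 Y_I[OF 2(2)]
        by (simp add: glued_harmonic_def harmonic_part_def restr_apply u(2) flip: q_def)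
          (simp add: q_def u(2))
    next
      case 3
      then have "x \<notin> \<Union>(S j)" using parts(4)[OF j] by auto
      then show ?thesis using 3 by (simp add: glued_harmonic_def restr_def)
    qed
  qed
  moreover have "a_on \<alpha> (In j) Y z = 0" if z: "z \<in> Vh0_on V (In j)" for z
  proof -
    interpret s: semi_inner V "a_on \<alpha> (In j)" by (rule semi_inner_a_on[OF I])
    have zV: "z \<in> V" using z Vh0_on_subset[OF I] by auto
    have "a_on \<alpha> (In j) Y z = a_on \<alpha> (In j) (u - q) z"
      using YV zV I by (rule a_on_cong) (auto simp: Y_I)
    also have "\<dots> = a_on \<alpha> (In j) u z - a_on \<alpha> (In j) q z" using u qV zV by (intro s.diff_left)
    also have "a_on \<alpha> (In j) u z = a_on \<alpha> (In j) (E (restr ?\<Gamma> t)) z"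
      unfolding u(2) using u(1) zV I by (rule a_on_cong) (simp_all add: restr_apply)
    finally show ?thesis using q_orth[OF z] by simp
  qed
  ultimately show ?thesis using YV Y_O by (intro bexI[of _ Y]) auto
qed

text \<open>
  Write \<open>r\<close> for the remainder of \<open>v\<close> after truncation of its eigenexpansion on the strip, and
  \<open>e = \<eta> r\<close>.  On the overlap the local component is \<open>e\<close>.  On the rest of the subdomain it is
  \<open>v - Y\<close> with \<open>Y\<close> discrete harmonic, and it has the trace of \<open>e\<close>; so \<open>v = Y + e + z\<close> with a
  function \<open>z\<close> of trace zero, and the energy of \<open>e + z\<close> exceeds that of \<open>v\<close> by at most that of \<open>e\<close>.
\<close>

lemma stable_local_component:
  assumes W: "finite B" "V = span B"
    and E: "trace_extension V (interface (Ov j) (In j)) (In j) E"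
    and D: "Ov j \<subseteq> D" "D \<subseteq> S j"
    and \<eta>: "lin_on (Vh_on V D) \<eta>" "\<And>v. v \<in> Vh_on V D \<Longrightarrow> \<eta> v \<in> Vh0_on V D"
      "\<And>v x. v \<in> Vh_on V (S j) \<Longrightarrow> x \<in> \<Union>(Ov j) \<Longrightarrow> \<eta> (restr (\<Union>D) v) x = \<xi> j v x"
    and eig: "eigensystem (a_on \<alpha> D) \<eta> (Vh_on V D) lam t"
    and m: "m + 1 \<le> dim (Vh_on V D)" "0 < lam (m + 1)" "lam (m + 1) < \<infinity>"
    and v: "v \<in> V"
  shows "\<exists>c. let w = \<xi> j (restr (\<Union>(S j)) v) -
      (\<Sum>k\<in>{1..m}. c k *\<^sub>R \<xi> j (glued_harmonic \<alpha> V (Ov j) (In j) E (t k))) in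
    w \<in> Vh0_on V (S j) \<and>
    a_on \<alpha> T w w \<le> (1 + 1 / real_of_ereal (lam (m + 1))) * a_on \<alpha> (S j) v v"
proof -
  define l where "l = real_of_ereal (lam (m + 1))"
  have l: "0 < l" using m by (cases "lam (m + 1)") (auto simp: l_def)
  have I: "In j \<subseteq> T" and O: "Ov j \<subseteq> T" and ST: "S j \<subseteq> T" and DT: "D \<subseteq> T"
    using parts[OF j] S_T D by auto
  have US: "\<Union>D \<subseteq> \<Union>(S j)" "\<Union>(Ov j) \<subseteq> \<Union>D" using D by auto
  interpret sD: semi_inner "Vh_on V D" "a_on \<alpha> D" by (rule semi_inner_Vh_on[OF DT])
  interpret sI: semi_inner V "a_on \<alpha> (In j)" by (rule semi_inner_a_on[OF I])
  have \<eta>V: "\<eta> x \<in> Vh_on V D" if "x \<in> Vh_on V D" for x using \<eta>(2)[OF that] Vh0_on_subset_Vh_on by auto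
  have vD: "restr (\<Union>D) v \<in> Vh_on V D" using v by (simp add: Vh_on_def)
  obtain c where c: "let r = restr (\<Union>D) v - (\<Sum>k\<in>{1..m}. c k *\<^sub>R t k) in
      a_on \<alpha> D (\<eta> r) (\<eta> r) \<le> a_on \<alpha> D (restr (\<Union>D) v) (restr (\<Union>D) v) / l"
    using sD.eigensystem_truncation[OF \<eta>(1) \<eta>V eig m vD] unfolding l_def by blast
  have tV: "t k \<in> Vh_on V D" if "k \<in> {1..m}" for k
  proof -
    have "k \<in> {1..dim (Vh_on V D)}" using that m(1) by auto
    moreover have "span (t ` {1..dim (Vh_on V D)}) = Vh_on V D"
      using eig by (simp add: eigensystem_def basis_on_def)
    ultimately show ?thesis by (metis imageI span_base)
  qed
  have "\<forall>k\<in>{1..m}. \<exists>Y\<in>V. glued_harmonic \<alpha> V (Ov j) (In j) E (t k) = restr (\<Union>(S j)) Y \<and>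
      (\<forall>x\<in>\<Union>(Ov j). Y x = t k x) \<and> (\<forall>z\<in>Vh0_on V (In j). a_on \<alpha> (In j) Y z = 0)"
    using glued_harmonic_extension[OF W E D(1) tV] by blast
  then obtain y where y: "\<And>k. k \<in> {1..m} \<Longrightarrow> y k \<in> V"
      "\<And>k. k \<in> {1..m} \<Longrightarrow> glued_harmonic \<alpha> V (Ov j) (In j) E (t k) = restr (\<Union>(S j)) (y k)"
      "\<And>k x. k \<in> {1..m} \<Longrightarrow> x \<in> \<Union>(Ov j) \<Longrightarrow> y k x = t k x"
      "\<And>k z. k \<in> {1..m} \<Longrightarrow> z \<in> Vh0_on V (In j) \<Longrightarrow> a_on \<alpha> (In j) (y k) z = 0"
    by metis
  define Y where "Y = (\<Sum>k\<in>{1..m}. c k *\<^sub>R y k)"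
  define r where "r = restr (\<Union>D) v - (\<Sum>k\<in>{1..m}. c k *\<^sub>R t k)"
  define e where "e = \<eta> r"
  define w where "w = \<xi> j (restr (\<Union>(S j)) (v - Y))"
  have YV: "Y \<in> V" unfolding Y_def using y(1) by (intro V_mem)
  have rV: "r \<in> Vh_on V D" unfolding r_def using vD tV by (intro sD.mem)
  have e: "e \<in> Vh0_on V D" unfolding e_def using rV by (rule \<eta>(2))
  have eV: "e \<in> V" using e Vh0_on_subset[OF DT] by auto
  have vS: "restr (\<Union>(S j)) (v - Y) \<in> Vh_on V (S j)"
    using v YV V_mem(3) by (auto simp: Vh_on_def)
  have w: "w \<in> Vh0_on V (S j)" unfolding w_def by (rule pou_range[OF vS])
  have wV: "w \<in> V" using w Vh0_on_subset[OF ST] by auto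
  have w_eq: "\<xi> j (restr (\<Union>(S j)) v) -
      (\<Sum>k\<in>{1..m}. c k *\<^sub>R \<xi> j (glued_harmonic \<alpha> V (Ov j) (In j) E (t k))) = w"
  proof -
    have add: "\<xi> j (f + g) = \<xi> j f + \<xi> j g" if "f \<in> Vh_on V (S j)" "g \<in> Vh_on V (S j)" for f g
      using pou_linear that by (simp add: lin_on_def)
    have scale: "\<xi> j (s *\<^sub>R f) = s *\<^sub>R \<xi> j f" if "f \<in> Vh_on V (S j)" for f s
      using pou_linear that by (simp add: lin_on_def)
    have mem: "restr (\<Union>(S j)) f \<in> Vh_on V (S j)" if "f \<in> V" for f using that by (simp add: Vh_on_def)
    have \<xi>0: "\<xi> j 0 = 0" using scale[of 0 0] subspace_0[OF Vh_on_subspace, of "S j"] by simp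
    have sum: "\<xi> j (restr (\<Union>(S j)) (\<Sum>k\<in>K. c k *\<^sub>R y k)) = (\<Sum>k\<in>K. c k *\<^sub>R \<xi> j (restr (\<Union>(S j)) (y k)))"
      if "finite K" "K \<subseteq> {1..m}" for K
      using that
    proof (induction K rule: finite_induct)
      case empty
      have "restr (\<Union>(S j)) 0 = (0 :: real ^ 'd \<Rightarrow> real)" by (auto simp: restr_def)
      then show ?case unfolding sum.empty using \<xi>0 by metis
    next
      case (insert k K)
      have V: "y k \<in> V" "(\<Sum>k\<in>K. c k *\<^sub>R y k) \<in> V"
        using insert.prems y(1) by (auto intro!: V_mem(2,4))
      have "\<xi> j (restr (\<Union>(S j)) (\<Sum>k\<in>insert k K. c k *\<^sub>R y k))
          = \<xi> j (restr (\<Union>(S j)) (c k *\<^sub>R y k) + restr (\<Union>(S j)) (\<Sum>k\<in>K. c k *\<^sub>R y k))"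
        unfolding sum.insert[OF insert.hyps] restr_add ..
      also have "\<dots> = \<xi> j (restr (\<Union>(S j)) (c k *\<^sub>R y k)) + \<xi> j (restr (\<Union>(S j)) (\<Sum>k\<in>K. c k *\<^sub>R y k))"
        by (rule add[OF mem[OF V_mem(2)[OF V(1)]] mem[OF V(2)]])
      also have "\<dots> = c k *\<^sub>R \<xi> j (restr (\<Union>(S j)) (y k)) + (\<Sum>k\<in>K. c k *\<^sub>R \<xi> j (restr (\<Union>(S j)) (y k)))"
        unfolding restr_scale scale[OF mem[OF V(1)]] using insert.IH insert.prems by simp
      finally show ?case unfolding sum.insert[OF insert.hyps] .
    qed
    have "w + \<xi> j (restr (\<Union>(S j)) Y) = \<xi> j (restr (\<Union>(S j)) (v - Y) + restr (\<Union>(S j)) Y)"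
      unfolding w_def by (rule add[symmetric, OF vS mem[OF YV]])
    also have "restr (\<Union>(S j)) (v - Y) + restr (\<Union>(S j)) Y = restr (\<Union>(S j)) v"
      unfolding restr_add[symmetric] by simp
    finally have "w = \<xi> j (restr (\<Union>(S j)) v) - \<xi> j (restr (\<Union>(S j)) Y)" unfolding eq_diff_eq .
    moreover have "\<xi> j (restr (\<Union>(S j)) Y) = (\<Sum>k\<in>{1..m}. c k *\<^sub>R \<xi> j (glued_harmonic \<alpha> V (Ov j) (In j) E (t k)))"
      unfolding Y_def using sum[of "{1..m}"] y(2) by simp
    ultimately show ?thesis by simp
  qed
  obtain R where R: "R \<in> V" "r = restr (\<Union>D) R" using rV by (auto simp: Vh_on_def)
  have Y_t: "Y x = (\<Sum>k\<in>{1..m}. c k *\<^sub>R t k) x" if "x \<in> \<Union>(Ov j)" for x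
    unfolding Y_def sum_fun_apply using y(3)[OF _ that] by (intro sum.cong refl) (simp add: scaleR_fun_def)
  have R_O: "R x = v x - Y x" if "x \<in> \<Union>(Ov j)" for x
  proof -
    have "x \<in> \<Union>D" using that US by auto
    then have "R x = r x" using R(2) by (simp add: restr_def)
    also have "\<dots> = v x - Y x" using \<open>x \<in> \<Union>D\<close> Y_t[OF that] by (simp add: r_def restr_def)
    finally show ?thesis .
  qed
  have RS: "restr (\<Union>(S j)) R \<in> Vh_on V (S j)" using R(1) by (simp add: Vh_on_def)
  \<comment> \<open>\<open>v - Y\<close> and \<open>R\<close> agree on the overlap, and \<open>\<xi>\<^sub>j\<close> acts locally there.\<close>
  have w_O: "w x = e x" if x: "x \<in> \<Union>(Ov j)" for x
  proof -
    have "restr (\<Union>(Ov j)) (restr (\<Union>(S j)) (v - Y)) = restr (\<Union>(Ov j)) (restr (\<Union>(S j)) R)"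
      using R_O US by (auto simp: restr_def fun_eq_iff)
    from pou_local[OF vS RS this] have "w x = \<xi> j (restr (\<Union>(S j)) R) x"
      unfolding w_def using x by (metis restr_apply)
    also have "\<dots> = \<eta> (restr (\<Union>D) (restr (\<Union>(S j)) R)) x" by (rule \<eta>(3)[OF RS x, symmetric])
    also have "\<dots> = e x" using R(2) US(1) by (simp add: e_def restr_restr)
    finally show ?thesis .
  qed
  have w_I: "w x = v x - Y x" if "x \<in> \<Union>(In j)" for x
    unfolding w_def using pou_identity_closure[OF V_mem(3)[OF v YV] that] by simp
  \<comment> \<open>Both \<open>w\<close> and \<open>e\<close> have the trace of \<open>\<xi>\<^sub>j R\<close> on the interface.\<close>
  define z where "z = restr (\<Union>(In j)) (w - e)"
  have z: "z \<in> Vh0_on V (In j)"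
    unfolding z_def using wV eV by (intro zero_trace_extension V_mem(3)) (auto simp: w_O interface_parts)
  have zV: "z \<in> V" using z Vh0_on_subset[OF I] by auto
  have orth: "a_on \<alpha> (In j) Y z = 0"
  proof -
    have "a_on \<alpha> (In j) Y z = (\<Sum>k\<in>{1..m}. c k * a_on \<alpha> (In j) (y k) z)"
      unfolding Y_def using y(1) zV
      by (subst sI.sum_left) (auto intro!: sum.cong V_mem(2) sI.scale_left)
    then show ?thesis using y(4)[OF _ z] by simp
  qed
  have "a_on \<alpha> (In j) w w = a_on \<alpha> (In j) (e + z) (e + z)"
    using wV wV I by (rule a_on_cong) (auto simp: z_def restr_def)
  also have "\<dots> \<le> a_on \<alpha> (In j) (Y + e + z) (Y + e + z) + a_on \<alpha> (In j) e e"
    by (rule sI.energy_off_orthogonal_part[OF YV eV zV orth])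
  also have "a_on \<alpha> (In j) (Y + e + z) (Y + e + z) = a_on \<alpha> (In j) v v"
    by (rule a_on_cong[symmetric, OF v v I]) (auto simp: z_def restr_def w_I)
  finally have in_le: "a_on \<alpha> (In j) w w \<le> a_on \<alpha> (In j) v v + a_on \<alpha> (In j) e e" .
  have ov: "a_on \<alpha> (Ov j) w w = a_on \<alpha> (Ov j) e e"
    using wV wV O by (rule a_on_cong) (auto simp: w_O)
  have split: "a_on \<alpha> (S j) f f = a_on \<alpha> (Ov j) f f + a_on \<alpha> (In j) f f" for f
    unfolding parts(4)[OF j] using parts[OF j] by (intro a_on_disjoint_Un) auto
  have "a_on \<alpha> T w w = a_on \<alpha> (S j) w w"
    using a_on_support[OF ST order.refl w] ST by (simp add: Int_absorb1)
  also have "\<dots> \<le> a_on \<alpha> (In j) v v + a_on \<alpha> (S j) e e" using split in_le ov by simp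
  also have "a_on \<alpha> (S j) e e = a_on \<alpha> D e e"
    using a_on_support[OF DT ST e] D(2) by (simp add: Int_absorb1)
  also have "a_on \<alpha> D e e \<le> a_on \<alpha> D v v / l"
    using c a_on_restr[OF v v DT] by (simp add: Let_def e_def r_def)
  also have "\<dots> \<le> a_on \<alpha> (S j) v v / l"
    using a_on_mono[OF D(2) ST v] l by (simp add: divide_right_mono)
  also have "a_on \<alpha> (In j) v v \<le> a_on \<alpha> (S j) v v"
    using parts(4)[OF j] by (intro a_on_mono ST v) auto
  finally have "a_on \<alpha> T w w \<le> (1 + 1 / l) * a_on \<alpha> (S j) v v" by (simp add: algebra_simps)
  then show ?thesis
    using w unfolding w_eq[symmetric] Let_def l_def by (intro exI[of _ c]) auto
qed

end

text \<open>
  The coarse component needs no estimate of its own: it is the difference of \<open>v\<close> and the sum of the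
  local components.
\<close>

lemma stable_decomposition:
  assumes v: "v \<in> V" and w: "\<And>j. j \<in> {1..N} \<Longrightarrow> w j \<in> Vh0_on V (S j)"
    and le: "\<And>j. j \<in> {1..N} \<Longrightarrow> a_on \<alpha> T (w j) (w j) \<le> C * a_on \<alpha> (S j) v v" and C: "0 \<le> C"
  defines "w0 \<equiv> v - (\<Sum>j\<in>{1..N}. w j)"
  shows "a_on \<alpha> T w0 w0 + (\<Sum>j\<in>{1..N}. a_on \<alpha> T (w j) (w j))
    \<le> (2 + k0 * (2 * k0 + 1) * C) * a_on \<alpha> T v v"
proof -
  interpret s: semi_inner V "a_on \<alpha> T" by (rule semi_inner_a_on[OF order.refl])
  define L where "L = (\<Sum>j\<in>{1..N}. a_on \<alpha> T (w j) (w j))"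
  have wV: "w j \<in> V" if "j \<in> {1..N}" for j
    using w[OF that] Vh0_on_subset[OF S_sub[OF that]] by auto
  have "L \<le> (\<Sum>j\<in>{1..N}. C * a_on \<alpha> (S j) v v)" unfolding L_def by (rule sum_mono[OF le])
  also have "\<dots> = C * (\<Sum>j\<in>{1..N}. a_on \<alpha> (S j) v v)" by (simp add: sum_distrib_left)
  also have "\<dots> \<le> C * (k0 * a_on \<alpha> T v v)"
    using C by (rule mult_left_mono[OF sum_subdomain_energies_le[OF v]])
  finally have L: "L \<le> C * (k0 * a_on \<alpha> T v v)" .
  have "a_on \<alpha> T w0 w0 \<le> 2 * a_on \<alpha> T v v + 2 * a_on \<alpha> T (\<Sum>j\<in>{1..N}. w j) (\<Sum>j\<in>{1..N}. w j)"
    unfolding w0_def using v wV by (intro s.norm_diff_le V_mem(4))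
  also have "\<dots> \<le> 2 * a_on \<alpha> T v v + 2 * (k0 * L)"
    using energy_sum_le[OF w] by (simp add: L_def)
  finally have "a_on \<alpha> T w0 w0 + L \<le> 2 * a_on \<alpha> T v v + (2 * k0 + 1) * L" by (simp add: algebra_simps)
  also have "\<dots> \<le> 2 * a_on \<alpha> T v v + (2 * k0 + 1) * (C * (k0 * a_on \<alpha> T v v))"
    using L by (intro add_left_mono mult_left_mono) auto
  finally show ?thesis by (simp add: L_def algebra_simps)
qed

end

section \<open>The condition number of the preconditioned matrix\<close>

theorem corollary10:
  fixes \<Omega> \<Gamma>D :: "(real ^ 'd) set"
    and T :: "(real ^ 'd) set set"
    and P :: "(real ^ 'd) set \<Rightarrow> (real ^ 'd \<Rightarrow> real) set"
    and Vh VH :: "(real ^ 'd \<Rightarrow> real) set"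
    and \<alpha> :: "real ^ 'd \<Rightarrow> real ^ 'd ^ 'd"
    and S Sstar :: "nat \<Rightarrow> (real ^ 'd) set set"
    and \<xi> \<eta> E :: "nat \<Rightarrow> (real ^ 'd \<Rightarrow> real) \<Rightarrow> (real ^ 'd \<Rightarrow> real)"
    and lam :: "nat \<Rightarrow> nat \<Rightarrow> ereal"
    and t \<psi> :: "nat \<Rightarrow> nat \<Rightarrow> real ^ 'd \<Rightarrow> real"
    and \<phi> \<psi>H :: "nat \<Rightarrow> real ^ 'd \<Rightarrow> real"
    and m p :: "nat \<Rightarrow> nat"
    and N n pH k0 :: nat
    and \<delta> :: real
    and A M :: "real mat"
  assumes dimension: "CARD('d) \<in> {2, 3}"
    and domain: "open \<Omega>" "connected \<Omega>" "\<Omega> \<noteq> {}" "negligible (frontier \<Omega>)"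
    and mesh: "is_mesh \<Omega> T"
    and Dirichlet_boundary: "\<Gamma>D \<subseteq> frontier \<Omega>"
    and shape: "\<forall>\<tau>\<in>T. shape_space \<tau> (P \<tau>)"
    and Vh: "Vh = fe_space T P \<Gamma>D"
    and conforming: "\<forall>v\<in>Vh. in_H1 \<Omega> v"
    and basis: "basis_on {..<n} \<phi> Vh"
    and well_defined: "\<forall>u\<in>Vh. \<forall>v\<in>Vh.
      set_integrable lebesgue \<Omega> (\<lambda>x. inner (\<alpha> x *v grad u x) (grad v x))"
    and continuous: "continuous_form_on Vh (H1_norm \<Omega>) (dform \<alpha> \<Omega>)"
    and symmetric: "symmetric_on Vh (dform \<alpha> \<Omega>)"
    and coercive: "coercive_on Vh (H1_norm \<Omega>) (dform \<alpha> \<Omega>)"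
    and psd: "\<forall>\<tau>\<in>T. psd_on Vh (dform \<alpha> \<tau>)"
    and N: "1 \<le> N"
    and decomposition: "\<forall>j\<in>{1..N}. S j \<subseteq> T" "(\<Union>j\<in>{1..N}. S j) = T"
    and k0: "k0 = max_multiplicity T N S"
    and pou: "partition_of_unity Vh N S \<xi>"
    and strip: "\<forall>j\<in>{1..N}. overlap N S j \<subseteq> Sstar j \<and> Sstar j \<subseteq> S j \<and> connected (\<Union>(Sstar j))"
    and interfaces: "\<forall>j\<in>{1..N}. interface (overlap N S j) (inner_part N S j) \<noteq> {} \<and>
      interface (Sstar j) (S j - Sstar j) \<noteq> {}"
    and \<delta>: "0 < \<delta>" "\<forall>j\<in>{1..N}. \<delta> \<le>
      setdist (interface (Sstar j) (S j - Sstar j)) (interface (overlap N S j) (inner_part N S j))"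
    and \<eta>: "\<forall>j\<in>{1..N}. lin_on (Vh_on Vh (Sstar j)) (\<eta> j) \<and>
      (\<forall>v\<in>Vh_on Vh (Sstar j). \<eta> j v \<in> Vh0_on Vh (Sstar j)) \<and>
      (\<forall>v\<in>Vh_on Vh (S j). \<forall>x\<in>\<Union>(overlap N S j). \<eta> j (restr (\<Union>(Sstar j)) v) x = \<xi> j v x)"
    and eigen: "\<forall>j\<in>{1..N}.
      eigensystem (a_on \<alpha> (Sstar j)) (\<eta> j) (Vh_on Vh (Sstar j)) (lam j) (t j)"
    and m: "\<forall>j\<in>{1..N}. 1 \<le> m j \<and> m j + 1 \<le> dim (Vh_on Vh (Sstar j)) \<and>
      0 < lam j (m j + 1) \<and> lam j (m j + 1) < \<infinity>"
    and E: "\<forall>j\<in>{1..N}. trace_extension Vh (interface (overlap N S j) (inner_part N S j))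
      (inner_part N S j) (E j)"
    and VH: "VH = coarse_space \<alpha> Vh N S \<xi> E t m"
    and local_bases: "\<forall>j\<in>{1..N}. basis_on {..<p j} (\<psi> j) (Vh0_on Vh (S j))"
    and coarse_basis: "basis_on {..<pH} \<psi>H VH"
    and A: "A = stiffness_mat (dform \<alpha> \<Omega>) n \<phi>"
    and M: "M = two_level_AS n A (embedding_mat n \<phi> pH \<psi>H)
      N (\<lambda>j. embedding_mat n \<phi> (p j) (\<psi> j))"
  shows "cond_number (M * A) \<le> (1 + real k0) * (2 + real k0 * (2 * real k0 + 1) *
    Max ((\<lambda>j. 2 + 3 / real_of_ereal (lam j (m j + 1))) ` {1..N}))"
proof -
  define Cmax where "Cmax = Max ((\<lambda>j. 2 + 3 / real_of_ereal (lam j (m j + 1))) ` {1..N})"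
  interpret fe: fe_decomposition \<Omega> \<Gamma>D T P Vh \<alpha> N S \<xi>
    using domain mesh shape Vh conforming well_defined coercive psd decomposition(1) pou
    by unfold_locales auto
  define U where "U j = Vh0_on Vh (S j)" for j
  define g where "g j k = \<xi> j (glued_harmonic \<alpha> Vh (overlap N S j) (inner_part N S j) (E j) (t j k))" for j k
  have VH_eq: "VH = span {g j k |j k. j \<in> {1..N} \<and> k \<in> {1..m j}}"
    by (simp add: VH coarse_space_def g_def)
  have B: "finite (\<phi> ` {..<n})" "Vh = span (\<phi> ` {..<n})"
    using basis by (simp_all add: basis_on_def)
  have a_eq: "dform \<alpha> \<Omega> u v = a_on \<alpha> T u v" if "u \<in> Vh" "v \<in> Vh" for u v
    using that by (rule fe.dform_domain)
  interpret aT: semi_inner Vh "a_on \<alpha> T" by (rule fe.semi_inner_a_on[OF order.refl])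
  interpret s: semi_inner Vh "dform \<alpha> \<Omega>"
    using aT.nonneg aT.commute aT.add_left aT.scale_left fe.V_subspace fe.V_mem
    by unfold_locales (auto simp: a_eq psd_on_def symmetric_on_def)
  have U_V: "U j \<subseteq> Vh" if "j \<in> {1..N}" for j
    unfolding U_def using fe.S_sub[OF that] by (rule fe.Vh0_on_subset)
  have lam_pos: "0 < real_of_ereal (lam j (m j + 1))" if "j \<in> {1..N}" for j
    using bspec[OF m that] by (cases "lam j (m j + 1)") auto
  have Cmax_ge: "2 + 3 / real_of_ereal (lam j (m j + 1)) \<le> Cmax" if "j \<in> {1..N}" for j
    unfolding Cmax_def using that by (intro Max_ge) auto
  have Cmax: "0 \<le> Cmax"
  proof -
    have "0 < 3 / real_of_ereal (lam 1 (m 1 + 1))" using lam_pos[of 1] N by simp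
    moreover have "2 + 3 / real_of_ereal (lam 1 (m 1 + 1)) \<le> Cmax" using N by (intro Cmax_ge) simp
    ultimately show ?thesis by linarith
  qed
  have n: "0 < n"
  proof (rule ccontr)
    assume "\<not> 0 < n"
    then have Vh0: "Vh = {0}" using B(2) by simp
    have "Vh_on Vh (Sstar 1) \<subseteq> {0}" by (auto simp: Vh0 Vh_on_def restr_def zero_fun_def)
    then have "dim (Vh_on Vh (Sstar 1)) \<le> card ({} :: (real ^ 'd \<Rightarrow> real) set)"
      by (intro dim_le_card) auto
    then show False using bspec[OF m, of 1] N by simp
  qed
  have local_bound: "\<exists>c. let w = \<xi> j (restr (\<Union>(S j)) v) - (\<Sum>k\<in>{1..m j}. c k *\<^sub>R g j k) in
      w \<in> U j \<and> a_on \<alpha> T w w \<le> Cmax * a_on \<alpha> (S j) v v" if j: "j \<in> {1..N}" and v: "v \<in> Vh" for j v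
  proof -
    have "lin_on (Vh_on Vh (Sstar j)) (\<eta> j)"
      and "\<And>v. v \<in> Vh_on Vh (Sstar j) \<Longrightarrow> \<eta> j v \<in> Vh0_on Vh (Sstar j)"
      and "\<And>v x. v \<in> Vh_on Vh (S j) \<Longrightarrow> x \<in> \<Union>(overlap N S j) \<Longrightarrow>
        \<eta> j (restr (\<Union>(Sstar j)) v) x = \<xi> j v x"
      using \<eta> j by blast+
    moreover have "overlap N S j \<subseteq> Sstar j" "Sstar j \<subseteq> S j" using strip j by auto
    ultimately obtain c where c: "let w = \<xi> j (restr (\<Union>(S j)) v) - (\<Sum>k\<in>{1..m j}. c k *\<^sub>R g j k) in
        w \<in> U j \<and> a_on \<alpha> T w w \<le> (1 + 1 / real_of_ereal (lam j (m j + 1))) * a_on \<alpha> (S j) v v"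
      using fe.stable_local_component[OF j B bspec[OF E j] _ _ _ _ _ bspec[OF eigen j] _ _ _ v] bspec[OF m j]
      unfolding g_def U_def by blast
    \<comment> \<open>The local estimate has the smaller constant \<open>1 + 1 / \<lambda>\<close>.\<close>
    have "1 + 1 / real_of_ereal (lam j (m j + 1)) \<le> 2 + 3 / real_of_ereal (lam j (m j + 1))"
      using lam_pos[OF j] by (simp add: field_simps)
    also note Cmax_ge[OF j]
    finally have "(1 + 1 / real_of_ereal (lam j (m j + 1))) * a_on \<alpha> (S j) v v \<le> Cmax * a_on \<alpha> (S j) v v"
      using semi_inner.nonneg[OF fe.semi_inner_a_on[OF fe.S_sub[OF j]] v] by (rule mult_right_mono)
    with c show ?thesis unfolding Let_def by (meson order.trans)
  qed
  have gU: "g j k \<in> U j" if j: "j \<in> {1..N}" and k: "k \<in> {1..m j}" for j k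
  proof -
    have "k \<in> {1..dim (Vh_on Vh (Sstar j))}" using bspec[OF m j] k by auto
    moreover have "span (t j ` {1..dim (Vh_on Vh (Sstar j))}) = Vh_on Vh (Sstar j)"
      using bspec[OF eigen j] by (simp add: eigensystem_def basis_on_def)
    ultimately have tV: "t j k \<in> Vh_on Vh (Sstar j)" by (metis imageI span_base)
    have "overlap N S j \<subseteq> Sstar j" using strip j by simp
    from fe.glued_harmonic_extension[OF j B bspec[OF E j] this tV]
    obtain Y where "Y \<in> Vh"
        "glued_harmonic \<alpha> Vh (overlap N S j) (inner_part N S j) (E j) (t j k) = restr (\<Union>(S j)) Y"
      by blast
    then show ?thesis unfolding g_def U_def by (intro fe.pou_range[OF j]) (simp add: Vh_on_def)
  qed
  have VH_sub: "VH \<subseteq> Vh"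
    unfolding VH_eq using gU U_V by (intro span_minimal fe.V_subspace) blast
  have "cond_number (M * A) \<le> (1 + real k0) * (2 + real k0 * (2 * real k0 + 1) * Cmax)"
    unfolding M A
  proof (rule s.cond_number_two_level_AS_le[OF _ basis n coarse_basis VH_sub, where W = U])
    show "v = 0" if "v \<in> Vh" "dform \<alpha> \<Omega> v v = 0" for v
      using that a_eq by (intro fe.definite) auto
    show "basis_on {..<p j} (\<psi> j) (U j)" "U j \<subseteq> Vh" if "j \<in> {1..N}" for j
      using local_bases U_V that by (auto simp: U_def)
    show "dform \<alpha> \<Omega> (\<Sum>j\<in>{1..N}. q j) (\<Sum>j\<in>{1..N}. q j) \<le> real k0 * (\<Sum>j\<in>{1..N}. dform \<alpha> \<Omega> (q j) (q j))"
      if q: "\<And>j. j \<in> {1..N} \<Longrightarrow> q j \<in> U j" for q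
    proof -
      have qV: "q j \<in> Vh" if "j \<in> {1..N}" for j using q U_V that by blast
      then have "(\<Sum>j\<in>{1..N}. q j) \<in> Vh" by (rule fe.V_mem(4))
      moreover have "(\<Sum>j\<in>{1..N}. dform \<alpha> \<Omega> (q j) (q j)) = (\<Sum>j\<in>{1..N}. a_on \<alpha> T (q j) (q j))"
        using qV a_eq by (intro sum.cong) auto
      ultimately show ?thesis using fe.energy_sum_le[of q] q by (simp add: a_eq k0 U_def)
    qed
    fix v assume v: "v \<in> Vh"
    have "\<forall>j\<in>{1..N}. \<exists>c. let w = \<xi> j (restr (\<Union>(S j)) v) - (\<Sum>k\<in>{1..m j}. c k *\<^sub>R g j k) in
        w \<in> U j \<and> a_on \<alpha> T w w \<le> Cmax * a_on \<alpha> (S j) v v"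
      by (intro ballI local_bound v)
    from bchoice[OF this] obtain c where
      c: "\<forall>j\<in>{1..N}. let w = \<xi> j (restr (\<Union>(S j)) v) - (\<Sum>k\<in>{1..m j}. c j k *\<^sub>R g j k) in
        w \<in> U j \<and> a_on \<alpha> T w w \<le> Cmax * a_on \<alpha> (S j) v v" ..
    define w where "w j = \<xi> j (restr (\<Union>(S j)) v) - (\<Sum>k\<in>{1..m j}. c j k *\<^sub>R g j k)" for j
    define w0 where "w0 = v - (\<Sum>j\<in>{1..N}. w j)"
    have w: "w j \<in> U j" "a_on \<alpha> T (w j) (w j) \<le> Cmax * a_on \<alpha> (S j) v v" if "j \<in> {1..N}" for j
      using bspec[OF c that] by (auto simp: w_def Let_def)
    have wV: "w j \<in> Vh" if "j \<in> {1..N}" for j using w(1) U_V that by blast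
    have w0V: "w0 \<in> Vh" unfolding w0_def using v wV by (intro fe.V_mem(3,4))
    have v_eq: "v = (\<Sum>j\<in>{1..N}. \<xi> j (restr (\<Union>(S j)) v))"
      using pou v by (simp add: partition_of_unity_def)
    have "w0 = (\<Sum>j\<in>{1..N}. \<xi> j (restr (\<Union>(S j)) v) - w j)"
      unfolding w0_def sum_subtractf using v_eq by metis
    also have "\<dots> = (\<Sum>j\<in>{1..N}. \<Sum>k\<in>{1..m j}. c j k *\<^sub>R g j k)"
      unfolding w_def by (intro sum.cong refl) (rule diff_diff_eq2[THEN trans, OF add_diff_cancel_left'])
    finally have w0_eq: "w0 = (\<Sum>j\<in>{1..N}. \<Sum>k\<in>{1..m j}. c j k *\<^sub>R g j k)" .
    have w0: "w0 \<in> VH" unfolding w0_eq VH_eq by (intro span_sum span_scale span_base) blast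
    have "a_on \<alpha> T w0 w0 + (\<Sum>j\<in>{1..N}. a_on \<alpha> T (w j) (w j))
        \<le> (2 + real k0 * (2 * real k0 + 1) * Cmax) * a_on \<alpha> T v v"
      unfolding w0_def k0 using fe.stable_decomposition[OF v _ w(2) Cmax] w(1) by (simp add: U_def)
    moreover have "(\<Sum>j\<in>{1..N}. dform \<alpha> \<Omega> (w j) (w j)) = (\<Sum>j\<in>{1..N}. a_on \<alpha> T (w j) (w j))"
      using wV a_eq by (intro sum.cong) auto
    ultimately have "dform \<alpha> \<Omega> w0 w0 + (\<Sum>j\<in>{1..N}. dform \<alpha> \<Omega> (w j) (w j))
        \<le> (2 + real k0 * (2 * real k0 + 1) * Cmax) * dform \<alpha> \<Omega> v v"
      using a_eq v w0V by simp
    moreover have "v = w0 + (\<Sum>j\<in>{1..N}. w j)"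
      unfolding w0_def by (rule diff_add_cancel[symmetric])
    ultimately show "\<exists>w0\<in>VH. \<exists>w. (\<forall>j\<in>{1..N}. w j \<in> U j) \<and> v = w0 + (\<Sum>j\<in>{1..N}. w j) \<and>
        dform \<alpha> \<Omega> w0 w0 + (\<Sum>j\<in>{1..N}. dform \<alpha> \<Omega> (w j) (w j))
        \<le> (2 + real k0 * (2 * real k0 + 1) * Cmax) * dform \<alpha> \<Omega> v v"
      using w0 w(1) by blast
  qed simp
  then show ?thesis unfolding Cmax_def .
qed

end
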